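(* Let $F$ be a field of characteristic $0$, $V=V_0\oplus V_1$ a $\mathbb{Z}_2$-graded $F$-vector space, and let $g(x_1,\dots,x_d)$ be a multilinear polynomial identity of $E\otimes E$. Let $m_1,\dots,m_d$ be monomials in $T(V)$ (i.e. tensor products of elements of $V$) such that $m_1\cdots m_d\in T^n(V)$. Then \[ g(m_1,\dots,m_d)*e_{(1^n)}=g(m_1,\dots,m_d)*e_{(n)}=0 . \]
   Context: $T(V)=\bigoplus_nT^n(V)$ is the tensor algebra with $T^n(V)=V^{\otimes n}$, products being tensor products. $S_n$ acts on the right on $T^n(V)$ by the signed place-permutation action $*$: for homogeneous $z_1,\dots,z_n\in V_0\cup V_1$ and $\sigma\in S_n$, $(z_1\otimes\cdots\otimes z_n)*\sigma=\varepsilon z_{\sigma(1)}\otimes\cdots\otimes z_{\sigma(n)}$ with $\varepsilon=(-1)^N$, $N$ the number of pairs of odd ($V_1$) factors whose relative order is reversed; extended linearly to $T^n(V)$ and to the group algebra $FS_n$. $e_{(n)}=\sum_{\sigma\in S_n}\sigma$ and $e_{(1^n)}=\sum_{\sigma\in S_n}\mathrm{sgn}(\sigma)\sigma$. $E$ is the infinite-dimensional Grassmann algebra over $F$ and $E\otimes E$ its tensor square. *)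

theory Defs
  imports
    "HOL-Library.Poly_Mapping"
    "HOL-Combinatorics.Permutations"
    "HOL-Algebra.Algebraic_Closure_Type"
begin

section \<open>Algebras given by generators and relations\<close>

text \<open>
  Words form the free monoid, written additively so that \<open>'x list \<Rightarrow>\<^sub>0 'f\<close>, with the convolution
  product of \<^theory>\<open>HOL-Library.Poly_Mapping\<close>, is the free unital associative algebra over \<open>'f\<close>
  on the set \<open>'x\<close>.  More generally \<open>'m \<Rightarrow>\<^sub>0 'f\<close> is the monoid algebra of \<open>'m\<close>.
\<close>

instantiation list :: (type) monoid_add
begin

definition zero_list :: "'a list" where "zero_list = []"

definition plus_list :: "'a list \<Rightarrow> 'a list \<Rightarrow> 'a list" where "plus_list = (@)"

instance
  by standard (simp_all add: zero_list_def plus_list_def)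

end

abbreviation monoid_algebra :: "('m::monoid_add \<Rightarrow>\<^sub>0 'f::field) ring"
  where "monoid_algebra \<equiv> ring_of_type_algebra"

definition pscale :: "'f::field \<Rightarrow> ('m::monoid_add \<Rightarrow>\<^sub>0 'f) \<Rightarrow> ('m \<Rightarrow>\<^sub>0 'f)"
  where "pscale c p = Poly_Mapping.single 0 c * p"

definition relation_ideal :: "('m::monoid_add \<Rightarrow>\<^sub>0 'f::field) set \<Rightarrow> ('m \<Rightarrow>\<^sub>0 'f) set"
  where "relation_ideal R = genideal monoid_algebra R"

definition quotient_class ::
  "('m::monoid_add \<Rightarrow>\<^sub>0 'f::field) set \<Rightarrow> ('m \<Rightarrow>\<^sub>0 'f) \<Rightarrow> ('m \<Rightarrow>\<^sub>0 'f) set"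
  where "quotient_class R p = relation_ideal R +>\<^bsub>monoid_algebra\<^esub> p"

definition quotient_algebra ::
  "('m::monoid_add \<Rightarrow>\<^sub>0 'f::field) set \<Rightarrow> ('f, ('m \<Rightarrow>\<^sub>0 'f) set) module"
  where
    "quotient_algebra R =
      (let Q = monoid_algebra Quot relation_ideal R
       in \<lparr>carrier = carrier Q, monoid.mult = monoid.mult Q, one = one Q, ring.zero = zero Q,
           add = add Q, module.smult = (\<lambda>c t. quotient_class R (pscale c 1) \<otimes>\<^bsub>Q\<^esub> t)\<rparr>)"

lemma carrier_monoid_algebra [simp]: "carrier monoid_algebra = UNIV"
  and mult_monoid_algebra [simp]: "x \<otimes>\<^bsub>monoid_algebra\<^esub> y = x * y"
  and one_monoid_algebra [simp]: "\<one>\<^bsub>monoid_algebra\<^esub> = 1"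
  and zero_monoid_algebra [simp]: "\<zero>\<^bsub>monoid_algebra\<^esub> = 0"
  and add_monoid_algebra [simp]: "x \<oplus>\<^bsub>monoid_algebra\<^esub> y = x + y"
  by (simp_all add: ring_of_type_algebra_def)

lemma ring_monoid_algebra: "ring (monoid_algebra :: ('m::monoid_add \<Rightarrow>\<^sub>0 'f::field) ring)"
proof -
  have "\<exists>y. x + y = 0" "\<exists>y. y + x = 0" for x :: "'m::monoid_add \<Rightarrow>\<^sub>0 'f::field"
    using add.right_inverse add.left_inverse by blast+
  then show ?thesis
    unfolding ring_of_type_algebra_def
    by unfold_locales (auto simp: algebra_simps Units_def)
qed

lemma ideal_monoid_algebraI:
  assumes "0 \<in> J" and add: "\<And>x y. x \<in> J \<Longrightarrow> y \<in> J \<Longrightarrow> x + y \<in> J"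
    and lmult: "\<And>a x. x \<in> J \<Longrightarrow> a * x \<in> J" and rmult: "\<And>a x. x \<in> J \<Longrightarrow> x * a \<in> J"
  shows "ideal J (monoid_algebra :: ('m::monoid_add \<Rightarrow>\<^sub>0 'f::field) ring)"
proof (rule idealI)
  interpret ring "monoid_algebra :: ('m \<Rightarrow>\<^sub>0 'f) ring" by (rule ring_monoid_algebra)
  show "subgroup J (add_monoid (monoid_algebra :: ('m \<Rightarrow>\<^sub>0 'f) ring))"
  proof
    fix x assume "x \<in> J"
    have "\<ominus>\<^bsub>monoid_algebra\<^esub> x = - x"
      by (rule minus_equality) simp_all
    then show "inv\<^bsub>add_monoid monoid_algebra\<^esub> x \<in> J"
      using lmult[OF \<open>x \<in> J\<close>, of "- 1"] by (simp add: a_inv_def)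
  qed (use assms in auto)
qed (use lmult rmult ring_monoid_algebra in auto)

lemma ideal_relation_ideal: "ideal (relation_ideal R) monoid_algebra"
  unfolding relation_ideal_def by (rule ring.genideal_ideal [OF ring_monoid_algebra]) simp

lemma relation_ideal_base: "r \<in> R \<Longrightarrow> r \<in> relation_ideal R"
  unfolding relation_ideal_def using ring.genideal_self [OF ring_monoid_algebra, of R] by auto

lemma relation_ideal_minimal: "ideal J monoid_algebra \<Longrightarrow> R \<subseteq> J \<Longrightarrow> relation_ideal R \<subseteq> J"
  unfolding relation_ideal_def by (rule ring.genideal_minimal [OF ring_monoid_algebra])

lemma relation_ideal_0: "0 \<in> relation_ideal R"
  using additive_subgroup.zero_closed [OF ideal.axioms(1) [OF ideal_relation_ideal]] by simp

lemma relation_ideal_add: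
  "x \<in> relation_ideal R \<Longrightarrow> y \<in> relation_ideal R \<Longrightarrow> x + y \<in> relation_ideal R"
  using additive_subgroup.a_closed [OF ideal.axioms(1) [OF ideal_relation_ideal], of x R y] by simp

lemma relation_ideal_lmult: "x \<in> relation_ideal R \<Longrightarrow> a * x \<in> relation_ideal R"
  using ideal.I_l_closed [OF ideal_relation_ideal, of x R a] by simp

lemma relation_ideal_rmult: "x \<in> relation_ideal R \<Longrightarrow> x * a \<in> relation_ideal R"
  using ideal.I_r_closed [OF ideal_relation_ideal, of x R a] by simp

lemma relation_ideal_uminus: "x \<in> relation_ideal R \<Longrightarrow> - x \<in> relation_ideal R"
  using relation_ideal_lmult [of x R "- 1"] by simp

lemma relation_ideal_uminus_iff: "- x \<in> relation_ideal R \<longleftrightarrow> x \<in> relation_ideal R"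
  using relation_ideal_uminus [of x R] relation_ideal_uminus [of "- x" R] by auto

lemma relation_ideal_diff:
  "x \<in> relation_ideal R \<Longrightarrow> y \<in> relation_ideal R \<Longrightarrow> x - y \<in> relation_ideal R"
  using relation_ideal_add[of x R "- y"] relation_ideal_uminus[of y R] by simp

lemma relation_ideal_sum:
  "(\<And>i. i \<in> A \<Longrightarrow> f i \<in> relation_ideal R) \<Longrightarrow> sum f A \<in> relation_ideal R"
  by (induction A rule: infinite_finite_induct) (auto intro: relation_ideal_0 relation_ideal_add)

lemma quotient_class_altdef: "quotient_class R p = {q. q - p \<in> relation_ideal R}"
  unfolding quotient_class_def a_r_coset_def'
  by (auto simp: algebra_simps)

lemma quotient_class_eq_iff: "quotient_class R p = quotient_class R q \<longleftrightarrow> p - q \<in> relation_ideal R"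
proof
  assume "quotient_class R p = quotient_class R q"
  moreover have "p \<in> quotient_class R p" by (simp add: quotient_class_altdef relation_ideal_0)
  ultimately show "p - q \<in> relation_ideal R" by (simp add: quotient_class_altdef)
next
  assume "p - q \<in> relation_ideal R"
  then show "quotient_class R p = quotient_class R q"
    unfolding quotient_class_altdef
    by (auto dest: relation_ideal_add[of _ R "p - q"] relation_ideal_diff[of _ R "p - q"])
qed

lemma quotient_algebra_simps:
  "carrier (quotient_algebra R) = range (quotient_class R)"
  "quotient_class R p \<oplus>\<^bsub>quotient_algebra R\<^esub> quotient_class R q = quotient_class R (p + q)"
  "quotient_class R p \<otimes>\<^bsub>quotient_algebra R\<^esub> quotient_class R q = quotient_class R (p * q)"
  "\<zero>\<^bsub>quotient_algebra R\<^esub> = quotient_class R 0"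
  "\<one>\<^bsub>quotient_algebra R\<^esub> = quotient_class R 1"
  "c \<odot>\<^bsub>quotient_algebra R\<^esub> quotient_class R p = quotient_class R (pscale c p)"
proof -
  interpret ideal "relation_ideal R" monoid_algebra by (rule ideal_relation_ideal)
  show "carrier (quotient_algebra R) = range (quotient_class R)"
    by (auto simp: quotient_algebra_def Let_def FactRing_def A_RCOSETS_def' quotient_class_def)
  show "quotient_class R p \<oplus>\<^bsub>quotient_algebra R\<^esub> quotient_class R q = quotient_class R (p + q)"
    using a_rcos_sum[of p q]
    by (simp add: quotient_algebra_def Let_def FactRing_def quotient_class_def)
  have mult: "quotient_class R p \<otimes>\<^bsub>quotient_algebra R\<^esub> quotient_class R q = quotient_class R (p * q)"
    for p q
    using rcoset_mult_add[of p q]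
    by (simp add: quotient_algebra_def Let_def FactRing_def quotient_class_def)
  show "quotient_class R p \<otimes>\<^bsub>quotient_algebra R\<^esub> quotient_class R q = quotient_class R (p * q)"
    by (rule mult)
  show "\<zero>\<^bsub>quotient_algebra R\<^esub> = quotient_class R 0"
    by (simp add: quotient_algebra_def Let_def FactRing_def quotient_class_altdef)
  show "\<one>\<^bsub>quotient_algebra R\<^esub> = quotient_class R 1"
    by (simp add: quotient_algebra_def Let_def FactRing_def quotient_class_def)
  show "c \<odot>\<^bsub>quotient_algebra R\<^esub> quotient_class R p = quotient_class R (pscale c p)"
    using mult[of "pscale c 1" p]
    by (simp add: quotient_algebra_def Let_def pscale_def)
qed


lemma poly_mapping_additive_induct [case_names single add]:
  fixes p :: "'k \<Rightarrow>\<^sub>0 'c::comm_monoid_add"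
  assumes single: "\<And>k c. P (Poly_Mapping.single k c)"
    and add: "\<And>p q. P p \<Longrightarrow> P q \<Longrightarrow> P (p + q)"
  shows "P p"
proof -
  have zero: "P 0"
    using single[of _ 0] by simp
  have "P (\<Sum>k\<in>A. Poly_Mapping.single k (f k))" if "finite A" for A :: "'k set" and f :: "'k \<Rightarrow> 'c"
    using that by (induction A rule: finite_induct) (auto intro: single add zero)
  moreover have "p = (\<Sum>k\<in>Poly_Mapping.keys p. Poly_Mapping.single k (Poly_Mapping.lookup p k))"
    by (rule poly_mapping_eqI) (auto simp: lookup_sum lookup_single when_def in_keys_iff)
  ultimately show ?thesis
    using finite_keys[of p] by metis
qed

lemma pscale_single: "pscale c (Poly_Mapping.single k d) = Poly_Mapping.single k (c * d)"
  by (simp add: pscale_def mult_single)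

lemma pscale_add: "pscale c (p + q) = pscale c p + pscale c q"
  and pscale_diff: "pscale c (p - q) = pscale c p - pscale c q"
  and pscale_sum: "pscale c (sum f A) = (\<Sum>x\<in>A. pscale c (f x))"
  and pscale_left_add: "pscale (c + d) p = pscale c p + pscale d p"
  and pscale_mult_left: "pscale c (p * q) = pscale c p * q"
  and pscale_0_left: "pscale 0 p = 0"
  and pscale_0_right: "pscale c 0 = 0"
  and pscale_pscale: "pscale c (pscale d p) = pscale (c * d) p"
  by (simp_all add: pscale_def algebra_simps sum_distrib_left single_add mult_single
      flip: mult.assoc)

lemma pscale_1: "pscale 1 p = p"
  by (simp add: pscale_def)

lemma pscale_mult_right: "pscale c (p * q) = p * pscale c q"
proof (induction p rule: poly_mapping_additive_induct)
  case (single k d)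
  show ?case
    by (induction q rule: poly_mapping_additive_induct)
      (simp_all add: pscale_single mult_single pscale_add distrib_left mult.left_commute)
qed (simp add: pscale_add distrib_right)

lemma lookup_pscale: "Poly_Mapping.lookup (pscale c p) k = c * Poly_Mapping.lookup p k"
  by (induction p rule: poly_mapping_additive_induct)
    (simp_all add: pscale_single lookup_single when_def pscale_add lookup_add distrib_left)

lemma vector_space_pscale: "vector_space pscale"
  by unfold_locales (simp_all add: pscale_add pscale_left_add pscale_pscale pscale_1)

lemma relation_ideal_pscale: "x \<in> relation_ideal R \<Longrightarrow> pscale c x \<in> relation_ideal R"
  unfolding pscale_def by (rule relation_ideal_lmult)


section \<open>Polynomial identities\<close>

text \<open>
  Noncommutative polynomials in variables \<open>x\<^sub>i\<close>, \<open>i\<close> a natural number, are elements of the free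
  algebra \<open>nat list \<Rightarrow>\<^sub>0 'f\<close>; the algebra in which they are evaluated is a \<open>module\<close> record.
\<close>

definition word_value :: "('f, 'a) module \<Rightarrow> (nat \<Rightarrow> 'a) \<Rightarrow> nat list \<Rightarrow> 'a"
  where "word_value A \<phi> w = foldr (\<lambda>i y. \<phi> i \<otimes>\<^bsub>A\<^esub> y) w \<one>\<^bsub>A\<^esub>"

definition evaluate :: "('f::zero, 'a) module \<Rightarrow> (nat list \<Rightarrow>\<^sub>0 'f) \<Rightarrow> (nat \<Rightarrow> 'a) \<Rightarrow> 'a"
  where "evaluate A g \<phi> =
    (\<Oplus>\<^bsub>A\<^esub>w\<in>Poly_Mapping.keys g. Poly_Mapping.lookup g w \<odot>\<^bsub>A\<^esub> word_value A \<phi> w)"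

definition polynomial_identity :: "('f::zero, 'a) module \<Rightarrow> (nat list \<Rightarrow>\<^sub>0 'f) \<Rightarrow> bool"
  where "polynomial_identity A g \<longleftrightarrow>
    (\<forall>\<phi>. (\<forall>i. \<phi> i \<in> carrier A) \<longrightarrow> evaluate A g \<phi> = \<zero>\<^bsub>A\<^esub>)"

definition multilinear :: "nat \<Rightarrow> (nat list \<Rightarrow>\<^sub>0 'f::zero) \<Rightarrow> bool"
  where "multilinear d g \<longleftrightarrow> (\<forall>w\<in>Poly_Mapping.keys g. distinct w \<and> set w = {1..d})"


section \<open>The Grassmann algebra and its tensor square\<close>

text \<open>
  \<open>E\<close> is the unital algebra on \<open>e\<^sub>0, e\<^sub>1, \<dots>\<close> with \<open>e\<^sub>i e\<^sub>j = - e\<^sub>j e\<^sub>i\<close> and \<open>e\<^sub>i\<^sup>2 = 0\<close>.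
\<close>

definition grassmann_relations :: "(nat list \<Rightarrow>\<^sub>0 'f::field) set"
  where "grassmann_relations =
    {Poly_Mapping.single [i, j] 1 + Poly_Mapping.single [j, i] 1 | i j. True} \<union>
    {Poly_Mapping.single [i, i] 1 | i. True}"

definition grassmann_eq :: "(nat list \<Rightarrow>\<^sub>0 'f::field) \<Rightarrow> (nat list \<Rightarrow>\<^sub>0 'f) \<Rightarrow> bool"
  where "grassmann_eq p q \<longleftrightarrow> p - q \<in> relation_ideal grassmann_relations"

quotient_type (overloaded) 'f grassmann = "nat list \<Rightarrow>\<^sub>0 'f::field" / grassmann_eq
proof (rule equivpI)
  show "reflp grassmann_eq"
    by (auto simp: reflp_def grassmann_eq_def relation_ideal_0)
  show "symp grassmann_eq"
    using relation_ideal_uminus by (fastforce simp: symp_def grassmann_eq_def)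
  show "transp grassmann_eq"
    using relation_ideal_add by (fastforce simp: transp_def grassmann_eq_def)
qed

lemma lookup_mult_Nil:
  "Poly_Mapping.lookup (p * q) [] = Poly_Mapping.lookup p [] * Poly_Mapping.lookup q []"
proof -
  have "(Poly_Mapping.lookup q m when [] = l + m) =
      ((Poly_Mapping.lookup q m when m = []) when l = [])" for l m
    by (auto simp: when_def plus_list_def)
  then show ?thesis
    by (simp add: lookup_mult mult_when Sum_any_when_independent)
qed

lemma one_notin_grassmann_ideal:
  "(1 :: nat list \<Rightarrow>\<^sub>0 'f::field) \<notin> relation_ideal grassmann_relations"
proof -
  let ?J = "{p :: nat list \<Rightarrow>\<^sub>0 'f. Poly_Mapping.lookup p [] = 0}"
  have "ideal ?J monoid_algebra"
    by (rule ideal_monoid_algebraI) (simp_all add: lookup_add lookup_mult_Nil)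
  moreover have "grassmann_relations \<subseteq> ?J"
    by (auto simp: grassmann_relations_def lookup_add lookup_single)
  ultimately have "relation_ideal grassmann_relations \<subseteq> ?J"
    by (rule relation_ideal_minimal)
  moreover have "(1 :: nat list \<Rightarrow>\<^sub>0 'f) \<notin> ?J"
    by (simp add: lookup_one zero_list_def)
  ultimately show ?thesis by blast
qed

instantiation grassmann :: (field) ring_1
begin

lift_definition zero_grassmann :: "'a grassmann" is 0 .

lift_definition one_grassmann :: "'a grassmann" is 1 .

lift_definition plus_grassmann :: "'a grassmann \<Rightarrow> 'a grassmann \<Rightarrow> 'a grassmann" is "(+)"
  unfolding grassmann_eq_def by (metis add_diff_add relation_ideal_add)

lift_definition uminus_grassmann :: "'a grassmann \<Rightarrow> 'a grassmann" is uminus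
  unfolding grassmann_eq_def by (metis minus_diff_minus relation_ideal_uminus)

lift_definition minus_grassmann :: "'a grassmann \<Rightarrow> 'a grassmann \<Rightarrow> 'a grassmann" is "(-)"
  unfolding grassmann_eq_def
proof -
  fix p p' q q' :: "nat list \<Rightarrow>\<^sub>0 'a"
  assume "p - p' \<in> relation_ideal grassmann_relations" "q - q' \<in> relation_ideal grassmann_relations"
  then have "(p - p') - (q - q') \<in> relation_ideal grassmann_relations"
    by (rule relation_ideal_diff)
  then show "p - q - (p' - q') \<in> relation_ideal grassmann_relations"
    by (simp add: algebra_simps)
qed

lift_definition times_grassmann :: "'a grassmann \<Rightarrow> 'a grassmann \<Rightarrow> 'a grassmann" is "(*)"
proof -
  fix p p' q q' :: "nat list \<Rightarrow>\<^sub>0 'a"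
  assume "grassmann_eq p p'" "grassmann_eq q q'"
  then have "(p - p') * q + p' * (q - q') \<in> relation_ideal grassmann_relations"
    unfolding grassmann_eq_def
    by (intro relation_ideal_add relation_ideal_lmult relation_ideal_rmult)
  then show "grassmann_eq (p * q) (p' * q')"
    by (simp add: grassmann_eq_def algebra_simps)
qed

instance
  by standard
    (transfer; simp add: grassmann_eq_def relation_ideal_0 one_notin_grassmann_ideal
      relation_ideal_uminus_iff algebra_simps)+

end

lift_definition grassmann_scale :: "'f::field \<Rightarrow> 'f grassmann \<Rightarrow> 'f grassmann" is pscale
  unfolding grassmann_eq_def pscale_def by (metis right_diff_distrib relation_ideal_lmult)

text \<open>
  The tensor product \<open>A \<otimes> B\<close> of two algebras with product \<open>(a \<otimes> b)(c \<otimes> d) = ac \<otimes> bd\<close>, as a quotient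
  of the free vector space on the symbols \<open>a \<boxtimes> b\<close>.  Multiplied by a symbol, a bilinearity relation
  becomes a bilinearity relation, so the ideal generated by these relations is just their linear
  span (lemma \<open>bilinear_ideal_eq_span\<close>), as in the tensor product of vector spaces.
\<close>

datatype ('a, 'b) tensor_symbol = Tensor_Symbol 'a 'b (infix \<open>\<boxtimes>\<close> 75)

instantiation tensor_symbol :: (monoid_mult, monoid_mult) monoid_add
begin

definition zero_tensor_symbol :: "('a, 'b) tensor_symbol"
  where "zero_tensor_symbol = 1 \<boxtimes> 1"

fun plus_tensor_symbol ::
  "('a, 'b) tensor_symbol \<Rightarrow> ('a, 'b) tensor_symbol \<Rightarrow> ('a, 'b) tensor_symbol"
  where "(a \<boxtimes> b) + (c \<boxtimes> d) = (a * c) \<boxtimes> (b * d)"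

instance
proof
  fix x y z :: "('a, 'b) tensor_symbol"
  show "x + y + z = x + (y + z)" by (cases x; cases y; cases z) (simp add: mult.assoc)
  show "0 + x = x" "x + 0 = x" by (cases x; simp add: zero_tensor_symbol_def)+
qed

end

definition bilinear_relations ::
  "('f \<Rightarrow> 'a \<Rightarrow> 'a) \<Rightarrow> ('f \<Rightarrow> 'b \<Rightarrow> 'b) \<Rightarrow> (('a::ring_1, 'b::ring_1) tensor_symbol \<Rightarrow>\<^sub>0 'f::field) set"
  where "bilinear_relations sA sB =
    {Poly_Mapping.single ((a + a') \<boxtimes> b) 1 - Poly_Mapping.single (a \<boxtimes> b) 1
       - Poly_Mapping.single (a' \<boxtimes> b) 1 | a a' b. True} \<union>
    {Poly_Mapping.single (a \<boxtimes> (b + b')) 1 - Poly_Mapping.single (a \<boxtimes> b) 1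
       - Poly_Mapping.single (a \<boxtimes> b') 1 | a b b'. True} \<union>
    {Poly_Mapping.single (sA c a \<boxtimes> b) 1 - pscale c (Poly_Mapping.single (a \<boxtimes> b) 1) | c a b. True} \<union>
    {Poly_Mapping.single (a \<boxtimes> sB c b) 1 - pscale c (Poly_Mapping.single (a \<boxtimes> b) 1) | c a b. True}"

lemma bilinear_ideal_eq_span:
  fixes sA :: "'f::field \<Rightarrow> 'a::ring_1 \<Rightarrow> 'a" and sB :: "'f \<Rightarrow> 'b::ring_1 \<Rightarrow> 'b"
  assumes sA: "\<And>c x y. sA c (x * y) = sA c x * y" "\<And>c x y. sA c (x * y) = x * sA c y"
    and sB: "\<And>c x y. sB c (x * y) = sB c x * y" "\<And>c x y. sB c (x * y) = x * sB c y"
  shows "relation_ideal (bilinear_relations sA sB) = module.span pscale (bilinear_relations sA sB)"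
    (is "relation_ideal ?R = _")
proof -
  interpret vector_space "pscale :: 'f \<Rightarrow> (('a, 'b) tensor_symbol \<Rightarrow>\<^sub>0 'f) \<Rightarrow> _"
    by (rule vector_space_pscale)
  have rel:
    "Poly_Mapping.single ((a + a') \<boxtimes> b) 1 - Poly_Mapping.single (a \<boxtimes> b) 1
       - Poly_Mapping.single (a' \<boxtimes> b) 1 \<in> ?R"
    "Poly_Mapping.single (a \<boxtimes> (b + b')) 1 - Poly_Mapping.single (a \<boxtimes> b) 1
       - Poly_Mapping.single (a \<boxtimes> b') 1 \<in> ?R"
    "Poly_Mapping.single (sA c a \<boxtimes> b) 1 - pscale c (Poly_Mapping.single (a \<boxtimes> b) 1) \<in> ?R"
    "Poly_Mapping.single (a \<boxtimes> sB c b) 1 - pscale c (Poly_Mapping.single (a \<boxtimes> b) 1) \<in> ?R"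
    for a a' b b' c
    unfolding bilinear_relations_def by blast+
  have relE: thesis if "r \<in> ?R"
    "\<And>a a' b. r = Poly_Mapping.single ((a + a') \<boxtimes> b) 1 - Poly_Mapping.single (a \<boxtimes> b) 1
       - Poly_Mapping.single (a' \<boxtimes> b) 1 \<Longrightarrow> thesis"
    "\<And>a b b'. r = Poly_Mapping.single (a \<boxtimes> (b + b')) 1 - Poly_Mapping.single (a \<boxtimes> b) 1
       - Poly_Mapping.single (a \<boxtimes> b') 1 \<Longrightarrow> thesis"
    "\<And>c a b. r = Poly_Mapping.single (sA c a \<boxtimes> b) 1 - pscale c (Poly_Mapping.single (a \<boxtimes> b) 1) \<Longrightarrow> thesis"
    "\<And>a c b. r = Poly_Mapping.single (a \<boxtimes> sB c b) 1 - pscale c (Poly_Mapping.single (a \<boxtimes> b) 1) \<Longrightarrow> thesis"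
    for r thesis
    using that(1) unfolding bilinear_relations_def
    by (elim UnE CollectE exE conjE) (rule that; assumption)+
  have lbase: "Poly_Mapping.single k 1 * r \<in> ?R" if "r \<in> ?R" for k r
  proof -
    obtain x y where k: "k = x \<boxtimes> y" by (cases k)
    from that show ?thesis
    proof (rule relE, goal_cases)
      case (1 a a1 b)
      then show ?thesis
        using rel(1)[of "x * a" "x * a1" "y * b"]
        by (simp add: k right_diff_distrib distrib_left mult_single sA(2) sB(2) pscale_single)
    next
      case (2 a b b1)
      then show ?thesis
        using rel(2)[of "x * a" "y * b" "y * b1"]
        by (simp add: k right_diff_distrib distrib_left mult_single sA(2) sB(2) pscale_single)
    next
      case (3 c a b)
      then show ?thesis
        using rel(3)[of c "x * a" "y * b"]
        by (simp add: k right_diff_distrib distrib_left mult_single sA(2) sB(2) pscale_single)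
    next
      case (4 a c b)
      then show ?thesis
        using rel(4)[of "x * a" c "y * b"]
        by (simp add: k right_diff_distrib distrib_left mult_single sA(2) sB(2) pscale_single)
    qed
  qed
  have rbase: "r * Poly_Mapping.single k 1 \<in> ?R" if "r \<in> ?R" for k r
  proof -
    obtain x y where k: "k = x \<boxtimes> y" by (cases k)
    from that show ?thesis
    proof (rule relE, goal_cases)
      case (1 a a1 b)
      then show ?thesis
        using rel(1)[of "a * x" "a1 * x" "b * y"]
        by (simp add: k left_diff_distrib distrib_right mult_single sA(1) sB(1) pscale_single)
    next
      case (2 a b b1)
      then show ?thesis
        using rel(2)[of "a * x" "b * y" "b1 * y"]
        by (simp add: k left_diff_distrib distrib_right mult_single sA(1) sB(1) pscale_single)
    next
      case (3 c a b)
      then show ?thesis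
        using rel(3)[of c "a * x" "b * y"]
        by (simp add: k left_diff_distrib distrib_right mult_single sA(1) sB(1) pscale_single)
    next
      case (4 a c b)
      then show ?thesis
        using rel(4)[of "a * x" c "b * y"]
        by (simp add: k left_diff_distrib distrib_right mult_single sA(1) sB(1) pscale_single)
    qed
  qed
  have single: "Poly_Mapping.single k c = pscale c (Poly_Mapping.single k 1)"
    for c :: 'f and k :: "('a, 'b) tensor_symbol"
    by (simp add: pscale_single)
  have lmult: "a * x \<in> span ?R" if "x \<in> span ?R" for a x
    using that
  proof (induction rule: span_induct_alt)
    case base
    show ?case by (simp add: span_zero)
  next
    case (step c r y)
    have "a * r \<in> span ?R"
    proof (induction a rule: poly_mapping_additive_induct)
      case (single k c)
      show ?case
        using span_scale[OF span_base[OF lbase[OF \<open>r \<in> ?R\<close>, of k]], of c]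
        by (simp only: pscale_mult_left pscale_single mult_1_right)
    qed (simp add: distrib_right span_add)
    then show ?case
      using step.IH by (simp add: distrib_left span_add span_scale flip: pscale_mult_right)
  qed
  have rmult: "x * a \<in> span ?R" if "x \<in> span ?R" for a x
    using that
  proof (induction rule: span_induct_alt)
    case base
    show ?case by (simp add: span_zero)
  next
    case (step c r y)
    have "r * a \<in> span ?R"
    proof (induction a rule: poly_mapping_additive_induct)
      case (single k c)
      show ?case
        using span_scale[OF span_base[OF rbase[OF \<open>r \<in> ?R\<close>, of k]], of c]
        by (simp only: pscale_mult_right pscale_single mult_1_right)
    qed (simp add: distrib_left span_add)
    then show ?case
      using step.IH by (simp add: distrib_right span_add span_scale flip: pscale_mult_left)
  qed
  show ?thesis
  proof
    show "relation_ideal ?R \<subseteq> span ?R"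
      by (intro relation_ideal_minimal ideal_monoid_algebraI)
        (auto intro: span_zero span_add lmult rmult span_base)
    show "span ?R \<subseteq> relation_ideal ?R"
      by (rule span_minimal)
        (auto simp: subspace_def intro: relation_ideal_0 relation_ideal_add relation_ideal_base
          relation_ideal_pscale)
  qed
qed

lemma grassmann_scale_mult_left: "grassmann_scale c (x * y) = grassmann_scale c x * y"
  by transfer (simp add: grassmann_eq_def pscale_mult_left relation_ideal_0)

lemma grassmann_scale_mult_right: "grassmann_scale c (x * y) = x * grassmann_scale c y"
  by transfer (simp add: grassmann_eq_def pscale_mult_right relation_ideal_0)

definition algebra_tensor_product ::
  "('f::field \<Rightarrow> 'a::ring_1 \<Rightarrow> 'a) \<Rightarrow> ('f \<Rightarrow> 'b::ring_1 \<Rightarrow> 'b) \<Rightarrow>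
    ('f, (('a, 'b) tensor_symbol \<Rightarrow>\<^sub>0 'f) set) module"
  where "algebra_tensor_product sA sB = quotient_algebra (bilinear_relations sA sB)"

definition grassmann_square ::
  "('f::field, (('f grassmann, 'f grassmann) tensor_symbol \<Rightarrow>\<^sub>0 'f) set) module"
  where "grassmann_square = algebra_tensor_product grassmann_scale grassmann_scale"


section \<open>The tensor algebra\<close>

definition tensor_relations ::
  "('f \<Rightarrow> 'v \<Rightarrow> 'v) \<Rightarrow> ('v::ab_group_add list \<Rightarrow>\<^sub>0 'f::field) set"
  where "tensor_relations scale =
    {Poly_Mapping.single [u + v] 1 - Poly_Mapping.single [u] 1 - Poly_Mapping.single [v] 1
       | u v. True} \<union>
    {Poly_Mapping.single [scale c v] 1 - pscale c (Poly_Mapping.single [v] 1) | c v. True}"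

definition tensor_algebra ::
  "('f \<Rightarrow> 'v \<Rightarrow> 'v) \<Rightarrow> ('f, ('v::ab_group_add list \<Rightarrow>\<^sub>0 'f::field) set) module"
  where "tensor_algebra scale = quotient_algebra (tensor_relations scale)"

abbreviation tensor_class ::
  "('f \<Rightarrow> 'v \<Rightarrow> 'v) \<Rightarrow> ('v::ab_group_add list \<Rightarrow>\<^sub>0 'f::field) \<Rightarrow> ('v list \<Rightarrow>\<^sub>0 'f) set"
  where "tensor_class scale \<equiv> quotient_class (tensor_relations scale)"

definition pure_tensor ::
  "('f \<Rightarrow> 'v \<Rightarrow> 'v) \<Rightarrow> 'v::ab_group_add list \<Rightarrow> ('v list \<Rightarrow>\<^sub>0 'f::field) set"
  where "pure_tensor scale vs = tensor_class scale (Poly_Mapping.single vs 1)"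

definition tensor_power ::
  "('f \<Rightarrow> 'v \<Rightarrow> 'v) \<Rightarrow> nat \<Rightarrow> ('v::ab_group_add list \<Rightarrow>\<^sub>0 'f::field) set set"
  where "tensor_power scale n =
    tensor_class scale ` {p. \<forall>w\<in>Poly_Mapping.keys p. length w = n}"


section \<open>The signed place-permutation action\<close>

locale graded_vector_space = vector_space scale
  for scale :: "'f::field \<Rightarrow> 'v::ab_group_add \<Rightarrow> 'v" +
  fixes V0 V1 :: "'v set"
  assumes subspace_V0: "subspace V0" and subspace_V1: "subspace V1"
    and direct_sum: "\<exists>!p. p \<in> V0 \<times> V1 \<and> v = fst p + snd p"

text \<open>The component of \<open>v\<close> in \<open>V1\<close> if the flag is true, in \<open>V0\<close> otherwise.\<close>

definition component :: "'v::ab_group_add set \<Rightarrow> 'v set \<Rightarrow> bool \<Rightarrow> 'v \<Rightarrow> 'v"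
  where "component V0 V1 b v =
    (let p = THE p. p \<in> V0 \<times> V1 \<and> v = fst p + snd p in if b then snd p else fst p)"

text \<open>
  Places are numbered from \<open>0\<close>, so \<open>S\<^sub>n\<close> consists of the permutations of \<open>{..<n}\<close>.  For a set
  \<open>S\<close> of places carrying odd factors, \<open>place_sign\<close> is the sign with which \<open>\<sigma>\<close> acts.
\<close>

definition place_sign :: "nat \<Rightarrow> (nat \<Rightarrow> nat) \<Rightarrow> nat set \<Rightarrow> 'f::field"
  where "place_sign n \<sigma> S =
    (- 1) ^ card {(i, j). i < j \<and> j < n \<and> \<sigma> i \<in> S \<and> \<sigma> j \<in> S \<and> \<sigma> j < \<sigma> i}"

text \<open>
  A tensor \<open>v\<^sub>0 \<otimes> \<dots> \<otimes> v\<^bsub>n-1\<^esub>\<close> of arbitrary vectors is the sum, over all sets \<open>S\<close> of places, of the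
  tensors of the homogeneous components that are odd exactly at the places in \<open>S\<close>.
\<close>

definition place_word ::
  "'v::ab_group_add set \<Rightarrow> 'v set \<Rightarrow> nat \<Rightarrow> (nat \<Rightarrow> nat) \<Rightarrow> 'v list \<Rightarrow> ('v list \<Rightarrow>\<^sub>0 'f::field)"
  where "place_word V0 V1 n \<sigma> vs =
    (\<Sum>S\<in>Pow {..<n}.
      Poly_Mapping.single (map (\<lambda>i. component V0 V1 (\<sigma> i \<in> S) (vs ! \<sigma> i)) [0..<n]) (place_sign n \<sigma> S))"

text \<open>Extended linearly, as \<open>0\<close> on the words of length other than \<open>n\<close>.\<close>

definition place_linear ::
  "'v::ab_group_add set \<Rightarrow> 'v set \<Rightarrow> nat \<Rightarrow> (nat \<Rightarrow> nat) \<Rightarrow> ('v list \<Rightarrow>\<^sub>0 'f::field) \<Rightarrow> ('v list \<Rightarrow>\<^sub>0 'f)"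
  where "place_linear V0 V1 n \<sigma> p =
    (\<Sum>w | w \<in> Poly_Mapping.keys p \<and> length w = n.
      pscale (Poly_Mapping.lookup p w) (place_word V0 V1 n \<sigma> w))"

definition place_action ::
  "('f \<Rightarrow> 'v \<Rightarrow> 'v) \<Rightarrow> 'v::ab_group_add set \<Rightarrow> 'v set \<Rightarrow> nat \<Rightarrow>
    ('v list \<Rightarrow>\<^sub>0 'f::field) set \<Rightarrow> (nat \<Rightarrow> nat) \<Rightarrow> ('v list \<Rightarrow>\<^sub>0 'f) set"
  where "place_action scale V0 V1 n t \<sigma> = (\<Union>p\<in>t. tensor_class scale (place_linear V0 V1 n \<sigma> p))"

text \<open>Elements of the group algebra of \<open>S\<^sub>n\<close> are finitely supported functions on permutations.\<close>

definition group_algebra_action ::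
  "('f \<Rightarrow> 'v \<Rightarrow> 'v) \<Rightarrow> 'v::ab_group_add set \<Rightarrow> 'v set \<Rightarrow> nat \<Rightarrow>
    ('v list \<Rightarrow>\<^sub>0 'f::field) set \<Rightarrow> ((nat \<Rightarrow> nat) \<Rightarrow>\<^sub>0 'f) \<Rightarrow> ('v list \<Rightarrow>\<^sub>0 'f) set"
  where "group_algebra_action scale V0 V1 n t a =
    (\<Oplus>\<^bsub>tensor_algebra scale\<^esub>\<sigma>\<in>Poly_Mapping.keys a.
      Poly_Mapping.lookup a \<sigma> \<odot>\<^bsub>tensor_algebra scale\<^esub> place_action scale V0 V1 n t \<sigma>)"

definition sym_element :: "nat \<Rightarrow> ((nat \<Rightarrow> nat) \<Rightarrow>\<^sub>0 'f::field)"
  where "sym_element n = (\<Sum>\<sigma> | \<sigma> permutes {..<n}. Poly_Mapping.single \<sigma> 1)"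

definition alt_element :: "nat \<Rightarrow> ((nat \<Rightarrow> nat) \<Rightarrow>\<^sub>0 'f::field)"
  where "alt_element n = (\<Sum>\<sigma> | \<sigma> permutes {..<n}. Poly_Mapping.single \<sigma> (of_int (sign \<sigma>)))"

subsection \<open>Adequacy of the action\<close>

lemma place_linear_superset:
  assumes "finite K" "Poly_Mapping.keys p \<subseteq> K"
  shows "place_linear V0 V1 n \<sigma> p =
    (\<Sum>w | w \<in> K \<and> length w = n. pscale (Poly_Mapping.lookup p w) (place_word V0 V1 n \<sigma> w))"
  unfolding place_linear_def
  by (rule sum.mono_neutral_left) (use assms in \<open>auto simp: in_keys_iff pscale_0_left\<close>)

lemma place_linear_add:
  "place_linear V0 V1 n \<sigma> (p + q) = place_linear V0 V1 n \<sigma> p + place_linear V0 V1 n \<sigma> q"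
proof -
  let ?K = "Poly_Mapping.keys p \<union> Poly_Mapping.keys q"
  have "finite ?K" "Poly_Mapping.keys (p + q) \<subseteq> ?K" "Poly_Mapping.keys p \<subseteq> ?K" "Poly_Mapping.keys q \<subseteq> ?K"
    using Poly_Mapping.keys_add[of p q] by auto
  then show ?thesis
    by (simp add: place_linear_superset[of ?K] lookup_add pscale_left_add sum.distrib)
qed

lemma place_linear_pscale:
  "place_linear V0 V1 n \<sigma> (pscale c p) = pscale c (place_linear V0 V1 n \<sigma> p)"
proof -
  have "Poly_Mapping.keys (pscale c p) \<subseteq> Poly_Mapping.keys p"
    by (auto simp: in_keys_iff lookup_pscale)
  then show ?thesis
    by (simp add: place_linear_superset[of "Poly_Mapping.keys p"] lookup_pscale pscale_sum pscale_pscale)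
qed

lemma place_linear_0: "place_linear V0 V1 n \<sigma> 0 = 0"
  by (simp add: place_linear_def)

lemma place_linear_diff:
  "place_linear V0 V1 n \<sigma> (p - q) = place_linear V0 V1 n \<sigma> p - place_linear V0 V1 n \<sigma> q"
  using place_linear_add[of V0 V1 n \<sigma> "p - q" q] by simp

lemma place_linear_single:
  "place_linear V0 V1 n \<sigma> (Poly_Mapping.single w c) =
    (if length w = n then pscale c (place_word V0 V1 n \<sigma> w) else 0)"
proof -
  have "{v. v \<in> {w} \<and> length v = n} = (if length w = n then {w} else {})" by auto
  then show ?thesis
    by (subst place_linear_superset[of "{w}"]) (auto simp: lookup_single)
qed

lemma word_relation_add:
  "Poly_Mapping.single (u @ [x + y] @ v) c - Poly_Mapping.single (u @ [x] @ v) c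
    - Poly_Mapping.single (u @ [y] @ v) c \<in> relation_ideal (tensor_relations scale)"
proof -
  have "Poly_Mapping.single u c *
      (Poly_Mapping.single [x + y] 1 - Poly_Mapping.single [x] 1 - Poly_Mapping.single [y] 1) *
      Poly_Mapping.single v 1 \<in> relation_ideal (tensor_relations scale)"
    by (intro relation_ideal_lmult relation_ideal_rmult relation_ideal_base)
      (auto simp: tensor_relations_def)
  then show ?thesis
    by (simp add: left_diff_distrib right_diff_distrib mult_single plus_list_def)
qed

lemma word_relation_scale:
  "Poly_Mapping.single (u @ [scale b x] @ v) c - Poly_Mapping.single (u @ [x] @ v) (b * c)
     \<in> relation_ideal (tensor_relations scale)"
proof -
  have "Poly_Mapping.single u c *
      (Poly_Mapping.single [scale b x] 1 - pscale b (Poly_Mapping.single [x] 1)) *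
      Poly_Mapping.single v 1 \<in> relation_ideal (tensor_relations scale)"
    by (intro relation_ideal_lmult relation_ideal_rmult relation_ideal_base)
      (auto simp: tensor_relations_def)
  then show ?thesis
    by (simp add: left_diff_distrib right_diff_distrib mult_single plus_list_def pscale_single
        mult.commute)
qed

lemma word_relation_zero:
  assumes "0 \<in> set w"
  shows "Poly_Mapping.single w c \<in> relation_ideal (tensor_relations scale)"
proof -
  obtain u v where "w = u @ [0] @ v"
    using split_list[OF assms] by auto
  then show ?thesis
    using relation_ideal_uminus[OF word_relation_add[of u 0 0 v c scale]] by simp
qed

context graded_vector_space
begin

lemma component_unique:
  assumes "x \<in> V0" "y \<in> V1"
  shows "component V0 V1 b (x + y) = (if b then y else x)"
proof -
  have "(THE p. p \<in> V0 \<times> V1 \<and> x + y = fst p + snd p) = (x, y)"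
    by (rule the1_equality[OF direct_sum]) (use assms in auto)
  then show ?thesis
    by (simp add: component_def)
qed

lemma component_cases:
  obtains x y where "x \<in> V0" "y \<in> V1" "v = x + y"
proof -
  obtain p where "p \<in> V0 \<times> V1" "v = fst p + snd p"
    using ex1_implies_ex[OF direct_sum[of v]] by blast
  then show thesis
    using that[of "fst p" "snd p"] by (simp add: mem_Times_iff)
qed

lemma component_add: "component V0 V1 b (v + w) = component V0 V1 b v + component V0 V1 b w"
proof -
  obtain x y where v: "x \<in> V0" "y \<in> V1" "v = x + y" by (rule component_cases)
  obtain x' y' where w: "x' \<in> V0" "y' \<in> V1" "w = x' + y'" by (rule component_cases)
  have sum: "v + w = (x + x') + (y + y')" and mem: "x + x' \<in> V0" "y + y' \<in> V1"
    using v w subspace_add[OF subspace_V0] subspace_add[OF subspace_V1] by auto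
  have "component V0 V1 b (v + w) = (if b then y + y' else x + x')"
    unfolding sum by (rule component_unique[OF mem])
  moreover have "component V0 V1 b v = (if b then y else x)"
    unfolding v(3) by (rule component_unique[OF v(1,2)])
  moreover have "component V0 V1 b w = (if b then y' else x')"
    unfolding w(3) by (rule component_unique[OF w(1,2)])
  ultimately show ?thesis
    by simp
qed

lemma component_scale: "component V0 V1 b (scale c v) = scale c (component V0 V1 b v)"
proof -
  obtain x y where v: "x \<in> V0" "y \<in> V1" "v = x + y" by (rule component_cases)
  then show ?thesis
    using component_unique[of "scale c x" "scale c y" b] component_unique[of x y b]
      subspace_scale[OF subspace_V0] subspace_scale[OF subspace_V1]
    by (simp add: scale_right_distrib split: if_splits)
qed

lemma component_homogeneous:
  assumes "v \<in> (if b then V1 else V0)"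
  shows "component V0 V1 b' v = (if b' = b then v else 0)"
  using assms component_unique[of 0 v b'] component_unique[of v 0 b']
    subspace_0[OF subspace_V0] subspace_0[OF subspace_V1]
  by (auto split: if_splits)

lemma place_word_split:
  assumes \<sigma>: "\<sigma> permutes {..<n}" and n: "n = length u + 1 + length v"
  obtains A B where "\<And>z. map (\<lambda>i. component V0 V1 (\<sigma> i \<in> S) ((u @ [z] @ v) ! \<sigma> i)) [0..<n]
    = A @ [component V0 V1 (length u \<in> S) z] @ B"
proof -
  let ?f = "\<lambda>z i. component V0 V1 (\<sigma> i \<in> S) ((u @ [z] @ v) ! \<sigma> i)"
  obtain j where \<sigma>j: "\<sigma> j = length u"
    using surjD[OF permutes_surj[OF \<sigma>], of "length u"] by metis
  have j: "j < n"
    using permutes_in_image[OF \<sigma>, of j] n by (simp add: \<sigma>j)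
  have fz: "?f z i = ?f 0 i" if "i \<noteq> j" for z i
  proof -
    have "\<sigma> i \<noteq> length u"
      using that injD[OF permutes_inj[OF \<sigma>], of i j] \<sigma>j by auto
    then show ?thesis
      by (simp add: nth_append nth_Cons split: nat.split)
  qed
  have f: "map (?f z) [0..<j] = map (?f 0) [0..<j]"
    "map (?f z) [Suc j..<n] = map (?f 0) [Suc j..<n]" for z
    by (rule map_cong[OF refl], rule fz, simp)+
  have upt: "[0..<n] = [0..<j] @ [j] @ [Suc j..<n]"
    using j upt_add_eq_append[of 0 j "n - j"] by (simp add: upt_conv_Cons)
  show thesis
  proof (rule that)
    fix z
    show "map (?f z) [0..<n] =
        map (?f 0) [0..<j] @ [component V0 V1 (length u \<in> S) z] @ map (?f 0) [Suc j..<n]"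
      unfolding upt map_append f[of z] by (simp add: \<sigma>j)
  qed
qed

lemma place_linear_ideal:
  assumes \<sigma>: "\<sigma> permutes {..<n}" and p: "p \<in> relation_ideal (tensor_relations scale)"
  shows "place_linear V0 V1 n \<sigma> p \<in> relation_ideal (tensor_relations scale)"
proof -
  let ?I = "relation_ideal (tensor_relations scale)"
  let ?L = "place_linear V0 V1 n \<sigma>"
  let ?J = "{p. \<forall>a b. ?L (a * p * b) \<in> ?I}"
  have word_add: "place_word V0 V1 n \<sigma> (u @ [x + y] @ v) - place_word V0 V1 n \<sigma> (u @ [x] @ v)
      - place_word V0 V1 n \<sigma> (u @ [y] @ v) \<in> ?I" if n: "n = length u + 1 + length v" for u v x y
  proof -
    have "Poly_Mapping.single (map (\<lambda>i. component V0 V1 (\<sigma> i \<in> S) ((u @ [x + y] @ v) ! \<sigma> i)) [0..<n])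
             (place_sign n \<sigma> S)
        - Poly_Mapping.single (map (\<lambda>i. component V0 V1 (\<sigma> i \<in> S) ((u @ [x] @ v) ! \<sigma> i)) [0..<n])
             (place_sign n \<sigma> S)
        - Poly_Mapping.single (map (\<lambda>i. component V0 V1 (\<sigma> i \<in> S) ((u @ [y] @ v) ! \<sigma> i)) [0..<n])
             (place_sign n \<sigma> S) \<in> ?I" for S
    proof -
      obtain A B where AB: "\<And>z. map (\<lambda>i. component V0 V1 (\<sigma> i \<in> S) ((u @ [z] @ v) ! \<sigma> i)) [0..<n]
          = A @ [component V0 V1 (length u \<in> S) z] @ B"
        by (rule place_word_split[OF \<sigma> n, of S]) blast
      show ?thesis
        unfolding AB component_add by (rule word_relation_add)
    qed
    then show ?thesis
      unfolding place_word_def sum_subtractf[symmetric] by (intro relation_ideal_sum)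
  qed
  have word_scale: "place_word V0 V1 n \<sigma> (u @ [scale c x] @ v)
      - pscale c (place_word V0 V1 n \<sigma> (u @ [x] @ v)) \<in> ?I"
    if n: "n = length u + 1 + length v" for u v x c
  proof -
    have "Poly_Mapping.single (map (\<lambda>i. component V0 V1 (\<sigma> i \<in> S) ((u @ [scale c x] @ v) ! \<sigma> i)) [0..<n])
             (place_sign n \<sigma> S)
        - Poly_Mapping.single (map (\<lambda>i. component V0 V1 (\<sigma> i \<in> S) ((u @ [x] @ v) ! \<sigma> i)) [0..<n])
             (c * place_sign n \<sigma> S) \<in> ?I" for S
    proof -
      obtain A B where AB: "\<And>z. map (\<lambda>i. component V0 V1 (\<sigma> i \<in> S) ((u @ [z] @ v) ! \<sigma> i)) [0..<n]
          = A @ [component V0 V1 (length u \<in> S) z] @ B"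
        by (rule place_word_split[OF \<sigma> n, of S]) blast
      show ?thesis
        unfolding AB component_scale by (rule word_relation_scale)
    qed
    then show ?thesis
      unfolding place_word_def pscale_sum pscale_single sum_subtractf[symmetric]
      by (intro relation_ideal_sum)
  qed
  have base: "?L (a * r * b) \<in> ?I" if r: "r \<in> tensor_relations scale" for a b r
  proof (induction a rule: poly_mapping_additive_induct)
    case (single u c)
    show ?case
    proof (induction b rule: poly_mapping_additive_induct)
      case (single v d)
      have *: "?L (Poly_Mapping.single u c * Poly_Mapping.single [x] e * Poly_Mapping.single v d) =
          (if n = length u + 1 + length v
           then pscale (c * d) (pscale e (place_word V0 V1 n \<sigma> (u @ [x] @ v))) else 0)" for x e
        by (auto simp: mult_single plus_list_def place_linear_single pscale_pscale mult_ac)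
      from r consider
          x y where "r = Poly_Mapping.single [x + y] 1 - Poly_Mapping.single [x] 1 - Poly_Mapping.single [y] 1"
        | e x where "r = Poly_Mapping.single [scale e x] 1 - pscale e (Poly_Mapping.single [x] 1)"
        unfolding tensor_relations_def by blast
      then show ?case
      proof cases
        case 1
        show ?thesis
          unfolding 1 left_diff_distrib right_diff_distrib place_linear_diff *
          using relation_ideal_pscale[OF word_add, of u v "c * d" x y]
          by (auto simp: pscale_diff pscale_1 relation_ideal_0)
      next
        case 2
        show ?thesis
          unfolding 2 pscale_single left_diff_distrib right_diff_distrib place_linear_diff *
          using relation_ideal_pscale[OF word_scale, of u v "c * d" e x]
          by (auto simp: pscale_diff pscale_1 relation_ideal_0)
      qed
    qed (simp add: distrib_left place_linear_add relation_ideal_add)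
  qed (simp add: distrib_right place_linear_add relation_ideal_add)
  have "ideal ?J monoid_algebra"
  proof (rule ideal_monoid_algebraI)
    fix x y assume "x \<in> ?J" "y \<in> ?J"
    then show "x + y \<in> ?J"
      by (simp add: distrib_left distrib_right place_linear_add relation_ideal_add)
  next
    fix a x assume x: "x \<in> ?J"
    then have "?L (a' * a * x * b) \<in> ?I" "?L (a' * x * (a * b)) \<in> ?I" for a' b
      by blast+
    then show "a * x \<in> ?J" "x * a \<in> ?J"
      by (simp_all add: mult.assoc)
  qed (simp add: place_linear_0 relation_ideal_0)
  then have "relation_ideal (tensor_relations scale) \<subseteq> ?J"
    by (rule relation_ideal_minimal) (use base in blast)
  with p have "?L (1 * p * 1) \<in> ?I" by blast
  then show ?thesis by simp
qed

lemma place_action_class: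
  assumes "\<sigma> permutes {..<n}"
  shows "place_action scale V0 V1 n (tensor_class scale p) \<sigma> =
    tensor_class scale (place_linear V0 V1 n \<sigma> p)"
proof -
  let ?C = "\<lambda>q. tensor_class scale (place_linear V0 V1 n \<sigma> q)"
  have "?C q = ?C p" if "q \<in> tensor_class scale p" for q
  proof -
    from that have "q - p \<in> relation_ideal (tensor_relations scale)"
      by (simp add: quotient_class_altdef)
    from place_linear_ideal[OF assms this] show ?thesis
      by (simp add: quotient_class_eq_iff place_linear_diff)
  qed
  then have "(\<Union>q\<in>tensor_class scale p. ?C q) = (\<Union>q\<in>tensor_class scale p. ?C p)"
    by (rule SUP_cong[OF refl])
  moreover have "p \<in> tensor_class scale p"
    by (simp add: quotient_class_altdef relation_ideal_0)
  ultimately show ?thesis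
    unfolding place_action_def by (metis SUP_const empty_iff)
qed

text \<open>On tensors of homogeneous vectors the action is the signed permutation of the factors.\<close>

lemma place_action_homogeneous:
  assumes \<sigma>: "\<sigma> permutes {..<n}" and len: "length zs = n" and S: "S \<subseteq> {..<n}"
    and hom: "\<And>i. i < n \<Longrightarrow> zs ! i \<in> (if i \<in> S then V1 else V0)"
  shows "place_action scale V0 V1 n (pure_tensor scale zs) \<sigma> =
    place_sign n \<sigma> S \<odot>\<^bsub>tensor_algebra scale\<^esub> pure_tensor scale (map (\<lambda>i. zs ! \<sigma> i) [0..<n])"
proof -
  let ?I = "relation_ideal (tensor_relations scale)"
  let ?t = "\<lambda>S'. Poly_Mapping.single
    (map (\<lambda>i. component V0 V1 (\<sigma> i \<in> S') (zs ! \<sigma> i)) [0..<n]) (place_sign n \<sigma> S') :: 'v list \<Rightarrow>\<^sub>0 'f"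
  have \<sigma>n: "\<sigma> i < n \<longleftrightarrow> i < n" for i
    using permutes_in_image[OF \<sigma>, of i] by simp
  have comp: "component V0 V1 (i \<in> S') (zs ! i) = (if i \<in> S' \<longleftrightarrow> i \<in> S then zs ! i else 0)"
    if "i < n" for i S'
    using component_homogeneous[OF hom[OF that], of "i \<in> S'"] by simp
  have "?t S' \<in> ?I" if "S' \<in> Pow {..<n} - {S}" for S'
  proof (rule word_relation_zero)
    from that S obtain k where k: "k < n" "(k \<in> S') \<noteq> (k \<in> S)" by blast
    obtain j where j: "\<sigma> j = k"
      using surjD[OF permutes_surj[OF \<sigma>], of k] by metis
    with k \<sigma>n[of j] have "j < n" by simp
    then show "0 \<in> set (map (\<lambda>i. component V0 V1 (\<sigma> i \<in> S') (zs ! \<sigma> i)) [0..<n])"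
      using k j comp[of k S'] by (auto intro!: image_eqI[of _ _ j])
  qed
  then have rest: "(\<Sum>S'\<in>Pow {..<n} - {S}. ?t S') \<in> ?I"
    by (rule relation_ideal_sum)
  have "?t S = Poly_Mapping.single (map (\<lambda>i. zs ! \<sigma> i) [0..<n]) (place_sign n \<sigma> S)"
    by (rule arg_cong[of _ _ "\<lambda>w. Poly_Mapping.single w _"]) (simp add: comp \<sigma>n)
  then have "place_word V0 V1 n \<sigma> zs =
      Poly_Mapping.single (map (\<lambda>i. zs ! \<sigma> i) [0..<n]) (place_sign n \<sigma> S) + (\<Sum>S'\<in>Pow {..<n} - {S}. ?t S')"
    unfolding place_word_def using S by (subst sum.remove[of _ S]) auto
  then have "place_word V0 V1 n \<sigma> zs
      - Poly_Mapping.single (map (\<lambda>i. zs ! \<sigma> i) [0..<n]) (place_sign n \<sigma> S) \<in> ?I"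
    using rest by (simp add: algebra_simps)
  then show ?thesis
    by (simp add: pure_tensor_def place_action_class[OF \<sigma>] place_linear_single len pscale_1
        tensor_algebra_def quotient_algebra_simps pscale_single quotient_class_eq_iff)
qed

end

end

(*
  Write m_1 ... m_d as one tensor with places 0, ..., n-1, the k-th monomial occupying a block B_k.
  A word w of g rearranges the places by a permutation t_w.  Applying the symmetriser and moving
  every t_w onto the summation variable, the multiplicativity of the signs shows that the
  contribution of the odd places S is a common tensor times the sum over w of
  g_w * eps_S(t_w) (for e_(n)) or g_w * eps_S(t_w) * sgn(t_w) (for e_(1^n)).  These sums vanish
  because they are coefficients of g evaluated in E (x) E at x_k = e(B_k Int S) (x) 1 and
  x_k = e(B_k Int S) (x) e(B_k), where e(B) is the product of the generators indexed by B: indeed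
  eps_S(t_w) is the sign that sorts the word t_w restricted to S, and sgn(t_w) = eps_S(t_w) for S
  the set of all places.
*)

theory Submission
  imports Defs
begin

section \<open>Linear functionals on monoid algebras\<close>

definition linear_extension :: "('k \<Rightarrow> 'f::field) \<Rightarrow> ('k \<Rightarrow>\<^sub>0 'f) \<Rightarrow> 'f"
  where "linear_extension l p = (\<Sum>k\<in>Poly_Mapping.keys p. Poly_Mapping.lookup p k * l k)"

lemma linear_extension_superset:
  assumes "finite K" "Poly_Mapping.keys p \<subseteq> K"
  shows "linear_extension l p = (\<Sum>k\<in>K. Poly_Mapping.lookup p k * l k)"
  unfolding linear_extension_def
  by (rule sum.mono_neutral_left) (use assms in \<open>auto simp: in_keys_iff\<close>)

lemma linear_extension_0 [simp]: "linear_extension l 0 = 0"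
  by (simp add: linear_extension_def)

lemma linear_extension_single [simp]: "linear_extension l (Poly_Mapping.single k c) = c * l k"
  by (subst linear_extension_superset[of "{k}"]) auto

lemma linear_extension_add:
  "linear_extension l (p + q) = linear_extension l p + linear_extension l q"
proof -
  let ?K = "Poly_Mapping.keys p \<union> Poly_Mapping.keys q"
  have "finite ?K" "Poly_Mapping.keys (p + q) \<subseteq> ?K"
    using Poly_Mapping.keys_add[of p q] by auto
  then show ?thesis
    by (simp add: linear_extension_superset[of ?K] lookup_add distrib_right sum.distrib)
qed

lemma linear_extension_diff:
  "linear_extension l (p - q) = linear_extension l p - linear_extension l q"
  using linear_extension_add[of l "p - q" q] by simp

lemma linear_extension_sum: "linear_extension l (sum f A) = (\<Sum>x\<in>A. linear_extension l (f x))"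
  by (induction A rule: infinite_finite_induct) (simp_all add: linear_extension_add)

lemma linear_extension_pscale: "linear_extension l (pscale c p) = c * linear_extension l p"
  by (induction p rule: poly_mapping_additive_induct)
    (simp_all add: pscale_single pscale_add linear_extension_add distrib_left)

text \<open>The kernel of a functional need not be an ideal, but the elements whose two-sided
  multiples all lie in the kernel form one. By additivity, testing monomial multipliers puts
  \<open>R\<close> into it, hence also the generated ideal.\<close>

lemma linear_extension_ideal:
  assumes rel: "\<And>r u c v d. r \<in> R \<Longrightarrow>
      linear_extension l (Poly_Mapping.single u c * r * Poly_Mapping.single v d) = 0"
    and p: "p \<in> relation_ideal R"
  shows "linear_extension l p = 0"
proof -
  let ?J = "{p. \<forall>a b. linear_extension l (a * p * b) = 0}"
  have base: "linear_extension l (a * r * b) = 0" if r: "r \<in> R" for a b r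
  proof (induction a rule: poly_mapping_additive_induct)
    case (single u c)
    show ?case
      by (induction b rule: poly_mapping_additive_induct)
        (simp_all add: rel[OF r] distrib_left linear_extension_add)
  qed (simp add: distrib_right linear_extension_add)
  have "ideal ?J monoid_algebra"
  proof (rule ideal_monoid_algebraI)
    fix x y assume "x \<in> ?J" "y \<in> ?J"
    then show "x + y \<in> ?J"
      by (simp add: distrib_left distrib_right linear_extension_add)
  next
    fix a x assume x: "x \<in> ?J"
    then have "linear_extension l (a' * a * x * b) = 0" "linear_extension l (a' * x * (a * b)) = 0"
      for a' b
      by blast+
    then show "a * x \<in> ?J" "x * a \<in> ?J"
      by (simp_all add: mult.assoc)
  qed simp
  then have "relation_ideal R \<subseteq> ?J"
    by (rule relation_ideal_minimal) (use base in blast)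
  with p have "linear_extension l (1 * p * 1) = 0" by blast
  then show ?thesis by simp
qed


section \<open>Evaluation in algebras given by relations\<close>

lemma abelian_monoid_quotient_algebra: "abelian_monoid (quotient_algebra R)"
  by (rule abelian_monoidI) (auto simp: quotient_algebra_simps add_ac)

lemma finsum_quotient_algebra:
  "(\<Oplus>\<^bsub>quotient_algebra R\<^esub>i\<in>A. quotient_class R (f i)) = quotient_class R (sum f A)"
proof -
  interpret abelian_monoid "quotient_algebra R" by (rule abelian_monoid_quotient_algebra)
  show ?thesis
    by (induction A rule: infinite_finite_induct) (simp_all add: quotient_algebra_simps)
qed

lemma word_value_quotient_algebra:
  assumes "\<And>i. i \<in> set w \<Longrightarrow> \<phi> i = quotient_class R (Poly_Mapping.single (h i) 1)"
  shows "word_value (quotient_algebra R) \<phi> w =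
    quotient_class R (Poly_Mapping.single (sum_list (map h w)) 1)"
  using assms
  by (induction w) (simp_all add: word_value_def quotient_algebra_simps mult_single)

text \<open>Serves both the tensor algebra, with pure tensors substituted, and the tensor square of
  \<open>E\<close>, with a Grassmann monomial in each factor. The assumption covers only variables
  occurring in \<open>g\<close>, because \<open>m k\<close> is known to be a pure tensor only for
  \<open>k\<close> in \<open>{1..d}\<close>.\<close>

lemma evaluate_quotient_algebra:
  assumes "\<And>w i. w \<in> Poly_Mapping.keys g \<Longrightarrow> i \<in> set w \<Longrightarrow>
      \<phi> i = quotient_class R (Poly_Mapping.single (h i) 1)"
  shows "evaluate (quotient_algebra R) g \<phi> =
    quotient_class R (\<Sum>w\<in>Poly_Mapping.keys g.
      Poly_Mapping.single (sum_list (map h w)) (Poly_Mapping.lookup g w))"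
proof -
  interpret abelian_monoid "quotient_algebra R" by (rule abelian_monoid_quotient_algebra)
  have "Poly_Mapping.lookup g w \<odot>\<^bsub>quotient_algebra R\<^esub> word_value (quotient_algebra R) \<phi> w =
      quotient_class R (Poly_Mapping.single (sum_list (map h w)) (Poly_Mapping.lookup g w))"
    if "w \<in> Poly_Mapping.keys g" for w
    using word_value_quotient_algebra[of w \<phi> R h] assms that
    by (simp add: quotient_algebra_simps pscale_single)
  then have "evaluate (quotient_algebra R) g \<phi> =
      (\<Oplus>\<^bsub>quotient_algebra R\<^esub>w\<in>Poly_Mapping.keys g.
        quotient_class R (Poly_Mapping.single (sum_list (map h w)) (Poly_Mapping.lookup g w)))"
    unfolding evaluate_def by (intro finsum_cong') (auto simp: quotient_algebra_simps)
  then show ?thesis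
    by (simp add: finsum_quotient_algebra)
qed


section \<open>Coefficients in the Grassmann algebra and its tensor square\<close>

text \<open>The parity sign of the number of inversions; for distinct letters, the sign picked up
  when anticommuting generators are sorted.\<close>

fun word_sign :: "nat list \<Rightarrow> 'f::field"
  where "word_sign [] = 1"
  | "word_sign (x # w) = (- 1) ^ length (filter (\<lambda>y. y < x) w) * word_sign w"

text \<open>Each letter of \<open>u\<close> or \<open>v\<close> has the same letters before and
  after it in both words, so only the pair \<open>i\<close>, \<open>j\<close> changes its
  contribution.\<close>

lemma word_sign_swap:
  assumes "i \<noteq> j"
  shows "word_sign (u @ [i, j] @ v) = - (word_sign (u @ [j, i] @ v) :: 'f::field)"
proof (induction u)
  case Nil
  show ?case
    using assms by (cases "i < j") simp_all
qed simp

text \<open>The recursion peels letters off the front; this form suits an induction in which the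
  range of places grows at its end.\<close>

lemma word_sign_snoc:
  "word_sign (w @ [x]) = word_sign w * ((- 1) ^ length (filter (\<lambda>y. x < y) w) :: 'f::field)"
proof (induction w)
  case (Cons y w)
  then show ?case
    by (cases "x < y") simp_all
qed simp

text \<open>The coefficient in \<open>E\<close> of the product of the generators indexed by \<open>S\<close> in increasing order.\<close>

definition word_coeff :: "nat set \<Rightarrow> nat list \<Rightarrow> 'f::field"
  where "word_coeff S w = (if distinct w \<and> set w = S then word_sign w else 0)"

text \<open>Makes the coefficient well defined on \<open>E\<close>: a multiple of a square repeats a
  letter, and the two terms of an anticommutator carry opposite signs.\<close>

lemma word_coeff_grassmann_ideal:
  assumes "p \<in> relation_ideal grassmann_relations"
  shows "linear_extension (word_coeff S) p = 0"
proof (rule linear_extension_ideal[OF _ assms])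
  fix r :: "nat list \<Rightarrow>\<^sub>0 'a" and u c v d
  assume r: "r \<in> grassmann_relations"
  have square: "word_coeff S (u @ [i, i] @ v) = (0 :: 'a)" for i
    by (simp add: word_coeff_def)
  have swap: "word_coeff S (u @ [i, j] @ v) + word_coeff S (u @ [j, i] @ v) = (0 :: 'a)" for i j
  proof (cases "i = j")
    case False
    have "set (u @ [i, j] @ v) = set (u @ [j, i] @ v)"
      "distinct (u @ [i, j] @ v) = distinct (u @ [j, i] @ v)"
      by auto
    then show ?thesis
      unfolding word_coeff_def word_sign_swap[OF False, of u v] by simp
  qed (simp add: square[simplified])
  from r consider i j where "r = Poly_Mapping.single [i, j] 1 + Poly_Mapping.single [j, i] 1"
    | i where "r = Poly_Mapping.single [i, i] 1"
    unfolding grassmann_relations_def by blast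
  then show "linear_extension (word_coeff S) (Poly_Mapping.single u c * r * Poly_Mapping.single v d) = 0"
  proof cases
    case (1 i j)
    have "linear_extension (word_coeff S) (Poly_Mapping.single u c * r * Poly_Mapping.single v d) =
        c * d * (word_coeff S (u @ [i, j] @ v) + word_coeff S (u @ [j, i] @ v))"
      unfolding 1
      by (simp add: mult_single plus_list_def linear_extension_add distrib_left distrib_right)
    then show ?thesis
      by (simp only: swap mult_zero_right)
  next
    case (2 i)
    then show ?thesis
      using square[of i] by (simp add: mult_single plus_list_def)
  qed
qed

lift_definition grassmann_coeff :: "nat set \<Rightarrow> 'f::field grassmann \<Rightarrow> 'f"
  is "\<lambda>S. linear_extension (word_coeff S)"
  using word_coeff_grassmann_ideal by (fastforce simp: grassmann_eq_def linear_extension_diff)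

lemma grassmann_coeff_add: "grassmann_coeff S (x + y) = grassmann_coeff S x + grassmann_coeff S y"
  by transfer (rule linear_extension_add)

lemma grassmann_coeff_scale: "grassmann_coeff S (grassmann_scale c x) = c * grassmann_coeff S x"
  by transfer (rule linear_extension_pscale)

lift_definition grassmann_monomial :: "nat list \<Rightarrow> 'f::field grassmann"
  is "\<lambda>w. Poly_Mapping.single w 1" .

lemma grassmann_coeff_monomial: "grassmann_coeff S (grassmann_monomial w) = word_coeff S w"
  by transfer simp

lemma grassmann_monomial_Nil: "grassmann_monomial [] = 1"
  by transfer (simp add: grassmann_eq_def relation_ideal_0 flip: zero_list_def)

lemma grassmann_monomial_append:
  "grassmann_monomial (u @ v) = grassmann_monomial u * grassmann_monomial v"
  by transfer (simp add: grassmann_eq_def relation_ideal_0 mult_single plus_list_def)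

section \<open>Coefficient functionals on the tensor square\<close>

definition square_coeff ::
  "nat set \<Rightarrow> nat set \<Rightarrow> ('f::field grassmann, 'f grassmann) tensor_symbol \<Rightarrow> 'f"
  where "square_coeff S T k = (case k of a \<boxtimes> b \<Rightarrow> grassmann_coeff S a * grassmann_coeff T b)"

text \<open>A product of linear functionals on the two factors is bilinear, so it kills each
  relation. Since the ideal is the linear span of the relations, no multiples have to be
  examined.\<close>

lemma square_coeff_ideal:
  assumes "p \<in> relation_ideal (bilinear_relations grassmann_scale grassmann_scale)"
  shows "linear_extension (square_coeff S T) p = 0"
proof -
  let ?R = "bilinear_relations grassmann_scale grassmann_scale ::
    (('a grassmann, 'a grassmann) tensor_symbol \<Rightarrow>\<^sub>0 'a) set"
  interpret vector_space "pscale :: 'a \<Rightarrow> (('a grassmann, 'a grassmann) tensor_symbol \<Rightarrow>\<^sub>0 'a) \<Rightarrow> _"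
    by (rule vector_space_pscale)
  have "p \<in> span ?R"
    using assms bilinear_ideal_eq_span[of "grassmann_scale :: 'a \<Rightarrow> _" grassmann_scale]
    by (simp add: grassmann_scale_mult_left flip: grassmann_scale_mult_right)
  then show ?thesis
  proof (induction rule: span_induct_alt)
    case (step c x y)
    from step.hyps have "linear_extension (square_coeff S T) x = 0"
      by (auto simp: bilinear_relations_def linear_extension_diff pscale_single square_coeff_def
          grassmann_coeff_add grassmann_coeff_scale distrib_left distrib_right)
    with step.IH show ?case
      by (simp add: linear_extension_add linear_extension_pscale)
  qed simp
qed

text \<open>Substituting for each variable a tensor of two Grassmann monomials turns every word into
  a single symbol; the sum is the coefficient at \<open>S\<close>, \<open>T\<close> of the vanishing
  value. This is how the hypothesis on \<open>g\<close> enters the proof.\<close>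

lemma grassmann_square_identity:
  fixes g :: "nat list \<Rightarrow>\<^sub>0 'f::field"
  assumes "polynomial_identity (grassmann_square :: ('f, _) module) g"
  shows "(\<Sum>w\<in>Poly_Mapping.keys g. Poly_Mapping.lookup g w *
    (word_coeff S (concat (map a w)) * word_coeff T (concat (map b w)))) = 0"
proof -
  let ?R = "bilinear_relations grassmann_scale grassmann_scale ::
    (('f grassmann, 'f grassmann) tensor_symbol \<Rightarrow>\<^sub>0 'f) set"
  define h :: "nat \<Rightarrow> ('f grassmann, 'f grassmann) tensor_symbol"
    where "h i = grassmann_monomial (a i) \<boxtimes> grassmann_monomial (b i)" for i
  have h: "sum_list (map h w) =
      grassmann_monomial (concat (map a w)) \<boxtimes> grassmann_monomial (concat (map b w))" for w
    by (induction w)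
      (simp_all add: h_def zero_tensor_symbol_def grassmann_monomial_Nil grassmann_monomial_append)
  let ?p = "\<Sum>w\<in>Poly_Mapping.keys g.
    Poly_Mapping.single (sum_list (map h w)) (Poly_Mapping.lookup g w)"
  have "evaluate (quotient_algebra ?R) g (\<lambda>i. quotient_class ?R (Poly_Mapping.single (h i) 1)) =
      quotient_class ?R 0"
    using assms
    by (simp add: polynomial_identity_def grassmann_square_def algebra_tensor_product_def
        quotient_algebra_simps)
  then have "quotient_class ?R ?p = quotient_class ?R 0"
    by (simp add: evaluate_quotient_algebra[where h = h])
  then have "linear_extension (square_coeff S T) ?p = 0"
    by (simp add: quotient_class_eq_iff square_coeff_ideal)
  then show ?thesis
    by (simp add: linear_extension_sum h square_coeff_def grassmann_coeff_monomial)
qed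

section \<open>Signs of place permutations\<close>

unbundle no m_inv_syntax

text \<open>The bridge between the action and \<open>E\<close>: the pairs counted on the left are
  the inversions of the word of values of \<open>\<sigma>\<close> restricted to letters in
  \<open>S\<close>.\<close>

lemma place_sign_eq_word_sign:
  "place_sign n \<sigma> S = (word_sign (filter (\<lambda>x. x \<in> S) (map \<sigma> [0..<n])) :: 'f::field)"
proof (induction n)
  case 0
  show ?case
    by (simp add: place_sign_def)
next
  case (Suc n)
  let ?I = "\<lambda>n. {(i, j). i < j \<and> j < n \<and> \<sigma> i \<in> S \<and> \<sigma> j \<in> S \<and> \<sigma> j < \<sigma> i}"
  \<comment> \<open>First entries of the pairs that appear when place \<open>n\<close> is added as
    second entry.\<close>
  let ?J = "{i. i < n \<and> \<sigma> i \<in> S \<and> \<sigma> n \<in> S \<and> \<sigma> n < \<sigma> i}"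
  have "finite (?I n)"
    by (rule finite_subset[of _ "{..<n} \<times> {..<n}"]) auto
  moreover have "?I (Suc n) = ?I n \<union> (\<lambda>i. (i, n)) ` ?J"
    by (auto simp: less_Suc_eq)
  ultimately have "card (?I (Suc n)) = card (?I n) + card ((\<lambda>i. (i, n)) ` ?J)"
    by (simp only:) (rule card_Un_disjoint, auto)
  also have "card ((\<lambda>i. (i, n)) ` ?J) = card ?J"
    by (rule card_image) (simp add: inj_on_def)
  also have "card ?J = (if \<sigma> n \<in> S then
      length (filter (\<lambda>y. \<sigma> n < y) (filter (\<lambda>x. x \<in> S) (map \<sigma> [0..<n]))) else 0)"
  proof (cases "\<sigma> n \<in> S")
    case True
    have "length (filter (\<lambda>y. \<sigma> n < y) (filter (\<lambda>x. x \<in> S) (map \<sigma> [0..<n]))) =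
        length (filter (\<lambda>i. \<sigma> i \<in> S \<and> \<sigma> n < \<sigma> i) [0..<n])"
      by (simp add: filter_map o_def conj_commute)
    also have "\<dots> = card (set (filter (\<lambda>i. \<sigma> i \<in> S \<and> \<sigma> n < \<sigma> i) [0..<n]))"
      by (rule distinct_card[symmetric]) simp
    also have "set (filter (\<lambda>i. \<sigma> i \<in> S \<and> \<sigma> n < \<sigma> i) [0..<n]) = ?J"
      using True by auto
    finally show ?thesis
      using True by simp
  qed simp
  finally show ?case
    using Suc.IH by (simp add: place_sign_def power_add word_sign_snoc)
qed

text \<open>Counts by values instead of places: a pair \<open>a < b\<close> in \<open>S\<close>
  contributes -1 exactly when its order under \<open>inv \<sigma>\<close> disagrees with its order
  under \<open>h\<close>. Signs of different permutations become products over one index set. The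
  identity as \<open>h\<close> gives \<open>place_sign\<close>; \<open>inv \<tau>\<close> as
  \<open>h\<close> gives the sign after relabelling.\<close>

lemma inversion_parity:
  assumes \<sigma>: "\<sigma> permutes {..<n}" and S: "S \<subseteq> {..<n}" and h: "inj (h :: nat \<Rightarrow> nat)"
  shows "(- 1) ^ card {(i, j). i < j \<and> j < n \<and> \<sigma> i \<in> S \<and> \<sigma> j \<in> S \<and> h (\<sigma> j) < h (\<sigma> i)} =
    (\<Prod>(a, b)\<in>{(a, b). a \<in> S \<and> b \<in> S \<and> a < b}.
      if inv \<sigma> a < inv \<sigma> b \<longleftrightarrow> h a < h b then 1 else - 1 :: 'f::field)"
proof -
  let ?I = "{(i, j). i < j \<and> j < n \<and> \<sigma> i \<in> S \<and> \<sigma> j \<in> S \<and> h (\<sigma> j) < h (\<sigma> i)}"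
  let ?P = "{(a, b). a \<in> S \<and> b \<in> S \<and> a < b}"
  let ?D = "{p \<in> ?P. \<not> (inv \<sigma> (fst p) < inv \<sigma> (snd p) \<longleftrightarrow> h (fst p) < h (snd p))}"
  have inv: "inv \<sigma> (\<sigma> i) = i" "\<sigma> (inv \<sigma> i) = i" for i
    using permutes_inverses[OF \<sigma>] by auto
  have inv_less: "inv \<sigma> a < n" if "a \<in> S" for a
    using permutes_in_image[OF permutes_inv[OF \<sigma>], of a] S that by auto
  have inj: "inv \<sigma> a = inv \<sigma> b \<longleftrightarrow> a = b" "h a = h b \<longleftrightarrow> a = b" for a b
    using inj_eq[OF permutes_inj[OF permutes_inv[OF \<sigma>]]] inj_eq[OF h] by auto
  \<comment> \<open>A pair of places goes to its values in increasing order, and a pair of values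
    back to its places in increasing order.\<close>
  have "bij_betw (\<lambda>(i, j). (min (\<sigma> i) (\<sigma> j), max (\<sigma> i) (\<sigma> j))) ?I ?D"
  proof (rule bij_betw_byWitness[where
        f' = "\<lambda>(a, b). (min (inv \<sigma> a) (inv \<sigma> b), max (inv \<sigma> a) (inv \<sigma> b))"])
    show "\<forall>p\<in>?I. (\<lambda>(a, b). (min (inv \<sigma> a) (inv \<sigma> b), max (inv \<sigma> a) (inv \<sigma> b)))
        ((\<lambda>(i, j). (min (\<sigma> i) (\<sigma> j), max (\<sigma> i) (\<sigma> j))) p) = p"
      by (auto simp: min_def max_def inv)
    show "\<forall>p\<in>?D. (\<lambda>(i, j). (min (\<sigma> i) (\<sigma> j), max (\<sigma> i) (\<sigma> j)))
        ((\<lambda>(a, b). (min (inv \<sigma> a) (inv \<sigma> b), max (inv \<sigma> a) (inv \<sigma> b))) p) = p"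
      by (auto simp: min_def max_def inv)
    show "(\<lambda>(i, j). (min (\<sigma> i) (\<sigma> j), max (\<sigma> i) (\<sigma> j))) ` ?I \<subseteq> ?D"
    proof (rule image_subsetI)
      fix p assume "p \<in> ?I"
      then obtain i j where p: "p = (i, j)"
        and *: "i < j" "\<sigma> i \<in> S" "\<sigma> j \<in> S" "h (\<sigma> j) < h (\<sigma> i)"
        by blast
      then have "\<sigma> i \<noteq> \<sigma> j" by auto
      with * show "(\<lambda>(i, j). (min (\<sigma> i) (\<sigma> j), max (\<sigma> i) (\<sigma> j))) p \<in> ?D"
        by (cases "\<sigma> i < \<sigma> j") (simp_all add: p min_def max_def inv)
    qed
    show "(\<lambda>(a, b). (min (inv \<sigma> a) (inv \<sigma> b), max (inv \<sigma> a) (inv \<sigma> b))) ` ?D \<subseteq> ?I"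
    proof (rule image_subsetI)
      fix p assume "p \<in> ?D"
      then obtain a b where p: "p = (a, b)" and *: "a \<in> S" "b \<in> S" "a < b"
        "\<not> (inv \<sigma> a < inv \<sigma> b \<longleftrightarrow> h a < h b)"
        by auto
      then have "inv \<sigma> a \<noteq> inv \<sigma> b" "h a \<noteq> h b" "inv \<sigma> a < n" "inv \<sigma> b < n"
        by (auto simp: inj inv_less)
      with * show "(\<lambda>(a, b). (min (inv \<sigma> a) (inv \<sigma> b), max (inv \<sigma> a) (inv \<sigma> b))) p \<in> ?I"
        by (cases "inv \<sigma> a < inv \<sigma> b") (auto simp: p min_def max_def inv)
    qed
  qed
  then have "card ?I = card ?D"
    by (rule bij_betw_same_card)
  moreover have fin: "finite ?P"
    by (rule finite_subset[of _ "S \<times> S"]) (use S finite_subset in auto)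
  then have "(- 1) ^ card ?D = (\<Prod>p\<in>?D. - 1 :: 'f)"
    by simp
  moreover have "\<dots> = (\<Prod>p\<in>?P.
      if inv \<sigma> (fst p) < inv \<sigma> (snd p) \<longleftrightarrow> h (fst p) < h (snd p) then 1 else - 1)"
    unfolding prod.inter_filter[OF fin] by (rule prod.cong) auto
  ultimately show ?thesis
    by (simp add: case_prod_beta)
qed

text \<open>Place \<open>i\<close> of a tensor rearranged by \<open>\<tau>\<close> carries the old
  factor \<open>\<tau> i\<close>, so the set of odd places becomes the preimage of \<open>S\<close>
  under \<open>\<tau>\<close>.\<close>

lemma place_sign_compose:
  assumes \<sigma>: "\<sigma> permutes {..<n}" and \<tau>: "\<tau> permutes {..<n}" and S: "S \<subseteq> {..<n}"
  shows "place_sign n (inv \<tau> \<circ> \<sigma>) (inv \<tau> ` S) = (place_sign n \<sigma> S * place_sign n \<tau> S :: 'f::field)"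
proof -
  let ?P = "{(a, b). a \<in> S \<and> b \<in> S \<and> a < b}"
  have inj: "inj (inv \<tau>)"
    using permutes_inj[OF permutes_inv[OF \<tau>]] .
  have "place_sign n (inv \<tau> \<circ> \<sigma>) (inv \<tau> ` S) = (\<Prod>(a, b)\<in>?P.
      if inv \<sigma> a < inv \<sigma> b \<longleftrightarrow> inv \<tau> a < inv \<tau> b then 1 else - 1 :: 'f)"
    unfolding inversion_parity[OF \<sigma> S inj, symmetric]
    by (simp add: place_sign_def inj_image_mem_iff[OF inj])
  \<comment> \<open>Two orders of a pair agree exactly when both agree or both disagree with the
    natural order.\<close>
  also have "\<dots> = (\<Prod>(a, b)\<in>?P. (if inv \<sigma> a < inv \<sigma> b \<longleftrightarrow> a < b then 1 else - 1) *
      (if inv \<tau> a < inv \<tau> b \<longleftrightarrow> a < b then 1 else - 1))"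
    by (rule prod.cong) auto
  also have "\<dots> = place_sign n \<sigma> S * place_sign n \<tau> S"
    using inversion_parity[OF \<sigma> S, of "\<lambda>x. x", where 'f = 'f]
      inversion_parity[OF \<tau> S, of "\<lambda>x. x", where 'f = 'f]
    by (simp add: place_sign_def case_prod_beta prod.distrib)
  finally show ?thesis .
qed

section \<open>Comparison with the sign of a permutation\<close>

lemma place_sign_transpose:
  assumes "a < n" "b < n" "a \<noteq> b"
  shows "place_sign n (Transposition.transpose a b) {..<n} = (- 1 :: 'f::field)"
proof -
  have "place_sign n (Transposition.transpose a b) {..<n} = (- 1 :: 'f)" if "a < b" "b < n" for a b
  proof -
    let ?t = "Transposition.transpose a b"
    \<comment> \<open>The inverted pairs are \<open>a\<close> with every place after it up to
      \<open>b\<close>, and every place strictly between with \<open>b\<close>: an odd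
      number.\<close>
    have "{(i, j). i < j \<and> j < n \<and> ?t i \<in> {..<n} \<and> ?t j \<in> {..<n} \<and> ?t j < ?t i} =
        {a} \<times> {a<..b} \<union> {a<..<b} \<times> {b}"
      using that by (auto simp: Transposition.transpose_def split: if_splits)
    also have "card \<dots> = (b - a) + (b - a - 1)"
      by (subst card_Un_disjoint) (auto simp: card_cartesian_product)
    also have "\<dots> = Suc (2 * (b - a - 1))"
      using that by simp
    finally show ?thesis
      by (simp add: place_sign_def)
  qed
  from this[of a b] this[of b a] show ?thesis
    using assms by (cases "a < b") (auto simp: transpose_commute[of a b])
qed

text \<open>Permutations of \<open>{..<n}\<close> preserve the full set of places, so
  \<open>place_sign_compose\<close> makes the sign multiplicative there; its value -1 on
  transpositions determines it.\<close>

lemma place_sign_eq_sign: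
  assumes "\<sigma> permutes {..<n}"
  shows "place_sign n \<sigma> {..<n} = (of_int (sign \<sigma>) :: 'f::field)"
  using assms finite_lessThan[of n]
proof (induction rule: permutes_induct)
  case id
  have "{(i, j). i < j \<and> j < n \<and> id i \<in> {..<n} \<and> id j \<in> {..<n} \<and> id j < id i} = {}"
    by auto
  then show ?case
    by (simp only: place_sign_def) simp
next
  case (swap a b p)
  let ?t = "Transposition.transpose a b"
  have t: "?t permutes {..<n}"
    using swap.hyps by (intro permutes_swap_id)
  have inv_t: "inv ?t = ?t"
    by (rule inv_equality) simp_all
  have "place_sign n (?t \<circ> p) {..<n} = (place_sign n p {..<n} * place_sign n ?t {..<n} :: 'f)"
    using place_sign_compose[OF swap.hyps(4) t subset_refl] permutes_image[OF t] by (simp add: inv_t)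
  also have "\<dots> = - of_int (sign p)"
    using swap place_sign_transpose[of a n b, where 'f = 'f] by simp
  also have "\<dots> = of_int (sign (?t \<circ> p))"
    using swap.hyps t permutation_permutes[of p] permutation_permutes[of ?t]
    by (subst sign_compose) (auto simp: sign_swap_id)
  finally show ?case .
qed

section \<open>Antisymmetrising the values of an identity\<close>

lemma list_permutes:
  assumes "distinct \<pi>" "set \<pi> = {..<n}"
  obtains \<tau> where "\<tau> permutes {..<n}" "map \<tau> [0..<n] = \<pi>"
proof
  \<comment> \<open>\<open>permutes\<close> asks for the identity outside
    \<open>{..<n}\<close>.\<close>
  let ?\<tau> = "\<lambda>i. if i < n then \<pi> ! i else i"
  have n: "length \<pi> = n"
    using distinct_card[OF assms(1)] assms(2) by simp
  have "bij_betw ((!) \<pi>) {..<n} {..<n}"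
    by (rule bij_betw_nth) (use assms n in auto)
  then have "bij_betw ?\<tau> {..<n} {..<n}"
    by (subst bij_betw_cong[where g = "(!) \<pi>"]) auto
  then show "?\<tau> permutes {..<n}"
    by (rule bij_imp_permutes) simp
  show "map ?\<tau> [0..<n] = \<pi>"
    by (rule nth_equalityI) (simp_all add: n)
qed

section \<open>Moving permutations onto the summation variable\<close>

lemma place_linear_sum:
  "place_linear V0 V1 n \<sigma> (sum f A) = (\<Sum>x\<in>A. place_linear V0 V1 n \<sigma> (f x))"
  by (induction A rule: infinite_finite_induct) (simp_all add: place_linear_0 place_linear_add)

lemma single_sum: "Poly_Mapping.single k (sum f A) = (\<Sum>x\<in>A. Poly_Mapping.single k (f x))"
  by (induction A rule: infinite_finite_induct) (simp_all add: single_add)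

text \<open>\<open>inv \<tau>\<close> undoes the rearrangement of \<open>W\<close>, so the resulting
  tensors are those of \<open>\<sigma>\<close> acting on \<open>W\<close> itself; what remains of
  \<open>\<tau>\<close> is one sign for each set of odd places.\<close>

lemma place_word_reindex:
  assumes \<sigma>: "\<sigma> permutes {..<n}" and \<tau>: "\<tau> permutes {..<n}"
  shows "place_word V0 V1 n (inv \<tau> \<circ> \<sigma>) (map (\<lambda>i. W ! \<tau> i) [0..<n]) =
    (\<Sum>S\<in>Pow {..<n}. Poly_Mapping.single
      (map (\<lambda>i. component V0 V1 (\<sigma> i \<in> S) (W ! \<sigma> i)) [0..<n])
      (place_sign n \<sigma> S * place_sign n \<tau> S :: 'f::field))"
proof -
  let ?t = "\<lambda>S. Poly_Mapping.single
    (map (\<lambda>i. component V0 V1 ((inv \<tau> \<circ> \<sigma>) i \<in> S)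
      (map (\<lambda>i. W ! \<tau> i) [0..<n] ! (inv \<tau> \<circ> \<sigma>) i)) [0..<n])
    (place_sign n (inv \<tau> \<circ> \<sigma>) S :: 'f)"
  have \<tau>': "inv \<tau> permutes {..<n}"
    using permutes_inv[OF \<tau>] .
  \<comment> \<open>Sets of odd places of the rearranged tensor are renamed by sets of odd places of
    \<open>W\<close>.\<close>
  have "bij_betw ((`) (inv \<tau>)) (Pow {..<n}) (Pow {..<n})"
    by (rule bij_betw_Pow[OF permutes_imp_bij[OF \<tau>']])
  then have "(\<Sum>S\<in>Pow {..<n}. ?t S) = (\<Sum>S\<in>Pow {..<n}. ?t (inv \<tau> ` S))"
    by (rule sum.reindex_bij_betw[symmetric])
  also have "\<dots> = (\<Sum>S\<in>Pow {..<n}. Poly_Mapping.single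
      (map (\<lambda>i. component V0 V1 (\<sigma> i \<in> S) (W ! \<sigma> i)) [0..<n])
      (place_sign n \<sigma> S * place_sign n \<tau> S))"
  proof (rule sum.cong[OF refl])
    fix S assume "S \<in> Pow {..<n}"
    moreover have "inv \<tau> (\<sigma> i) < n" if "i < n" for i
      using that permutes_in_image[OF \<tau>', of "\<sigma> i"] permutes_in_image[OF \<sigma>, of i] by simp
    ultimately show "?t (inv \<tau> ` S) = Poly_Mapping.single
        (map (\<lambda>i. component V0 V1 (\<sigma> i \<in> S) (W ! \<sigma> i)) [0..<n])
        (place_sign n \<sigma> S * place_sign n \<tau> S)"
      using place_sign_compose[OF \<sigma> \<tau>, of S, where 'f = 'f] permutes_inverses(1)[OF \<tau>]
        inj_image_mem_iff[OF permutes_inj[OF \<tau>']]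
      by (intro arg_cong2[where f = Poly_Mapping.single]) (auto simp: comp_def)
  qed
  finally show ?thesis
    by (simp add: place_word_def)
qed

text \<open>
  Moving all permutations onto \<open>\<sigma>\<close> collects the coefficient of each basis tensor into
  the signed sum that vanishes by hypothesis.
\<close>

lemma signed_sum_place_word:
  fixes c :: "'k \<Rightarrow> 'f::field" and \<tau> :: "'k \<Rightarrow> nat \<Rightarrow> nat"
  assumes \<tau>: "\<And>k. k \<in> K \<Longrightarrow> \<tau> k permutes {..<n}"
    and T: "T = {} \<or> T = {..<n}"
    and zero: "\<And>S. S \<subseteq> {..<n} \<Longrightarrow>
      (\<Sum>k\<in>K. c k * (place_sign n (\<tau> k) S * place_sign n (\<tau> k) T)) = 0"
  shows "(\<Sum>\<sigma> | \<sigma> permutes {..<n}. pscale (place_sign n \<sigma> T)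
    (\<Sum>k\<in>K. pscale (c k) (place_word V0 V1 n \<sigma> (map (\<lambda>i. W ! \<tau> k i) [0..<n])))) = 0"
proof -
  let ?w = "\<lambda>\<sigma> S. map (\<lambda>i. component V0 V1 (\<sigma> i \<in> S) (W ! \<sigma> i)) [0..<n]"
  let ?P = "{\<sigma>. \<sigma> permutes {..<n}}"
  let ?t = "\<lambda>k \<sigma>. pscale (place_sign n \<sigma> T * c k)
    (place_word V0 V1 n \<sigma> (map (\<lambda>i. W ! \<tau> k i) [0..<n]))"
  have "(\<Sum>\<sigma>\<in>?P. pscale (place_sign n \<sigma> T)
      (\<Sum>k\<in>K. pscale (c k) (place_word V0 V1 n \<sigma> (map (\<lambda>i. W ! \<tau> k i) [0..<n])))) =
      (\<Sum>k\<in>K. \<Sum>\<sigma>\<in>?P. ?t k \<sigma>)"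
    by (subst sum.swap) (simp add: pscale_sum pscale_pscale)
  \<comment> \<open>For each \<open>k\<close> separately, left composition with
    \<open>inv (\<tau> k)\<close> permutes the symmetric group; afterwards the tensors depend on
    \<open>\<sigma>\<close> and \<open>S\<close> but not on \<open>k\<close>.\<close>
  also have "\<dots> = (\<Sum>k\<in>K. \<Sum>\<sigma>\<in>?P. ?t k (inv (\<tau> k) \<circ> \<sigma>))"
    by (intro sum.cong refl setum_permutations_compose_left permutes_inv \<tau>)
  also have "\<dots> = (\<Sum>k\<in>K. \<Sum>\<sigma>\<in>?P. \<Sum>S\<in>Pow {..<n}. Poly_Mapping.single (?w \<sigma> S)
      (place_sign n \<sigma> T * place_sign n \<sigma> S * (c k * (place_sign n (\<tau> k) S * place_sign n (\<tau> k) T))))"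
  proof (intro sum.cong refl)
    fix k \<sigma> assume k: "k \<in> K" and "\<sigma> \<in> ?P"
    then have \<sigma>: "\<sigma> permutes {..<n}" by simp
    \<comment> \<open>The empty and the full set are fixed by every permutation of the places, so
      the sign at \<open>T\<close> is multiplicative under this substitution.\<close>
    have "inv (\<tau> k) ` T = T" "T \<subseteq> {..<n}"
      using T permutes_image[OF permutes_inv[OF \<tau>[OF k]]] by auto
    then have "place_sign n (inv (\<tau> k) \<circ> \<sigma>) T = (place_sign n \<sigma> T * place_sign n (\<tau> k) T :: 'f)"
      using place_sign_compose[OF \<sigma> \<tau>[OF k], of T] by simp
    then show "?t k (inv (\<tau> k) \<circ> \<sigma>) = (\<Sum>S\<in>Pow {..<n}. Poly_Mapping.single (?w \<sigma> S)
        (place_sign n \<sigma> T * place_sign n \<sigma> S *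
          (c k * (place_sign n (\<tau> k) S * place_sign n (\<tau> k) T))))"
      by (simp add: place_word_reindex[OF \<sigma> \<tau>[OF k]] pscale_sum pscale_single mult_ac)
  qed
  also have "\<dots> = (\<Sum>\<sigma>\<in>?P. \<Sum>S\<in>Pow {..<n}. \<Sum>k\<in>K. Poly_Mapping.single (?w \<sigma> S)
      (place_sign n \<sigma> T * place_sign n \<sigma> S * (c k * (place_sign n (\<tau> k) S * place_sign n (\<tau> k) T))))"
    by (subst sum.swap, rule sum.cong[OF refl], rule sum.swap)
  also have "\<dots> = (\<Sum>\<sigma>\<in>?P. \<Sum>S\<in>Pow {..<n}. Poly_Mapping.single (?w \<sigma> S)
      (place_sign n \<sigma> T * place_sign n \<sigma> S *
        (\<Sum>k\<in>K. c k * (place_sign n (\<tau> k) S * place_sign n (\<tau> k) T))))"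
    by (simp add: sum_distrib_left single_sum)
  also have "\<dots> = 0"
    by (simp add: zero)
  finally show ?thesis .
qed

text \<open>Reduces the action to representatives. The definition sums over the support of the group
  algebra element, which is smaller than the symmetric group when some \<open>c \<sigma>\<close> is
  zero; the missing terms vanish.\<close>

lemma (in graded_vector_space) group_algebra_action_class:
  "group_algebra_action scale V0 V1 n (tensor_class scale p)
      (\<Sum>\<sigma> | \<sigma> permutes {..<n}. Poly_Mapping.single \<sigma> (c \<sigma>)) =
    tensor_class scale (\<Sum>\<sigma> | \<sigma> permutes {..<n}. pscale (c \<sigma>) (place_linear V0 V1 n \<sigma> p))"
proof -
  interpret T: abelian_monoid "tensor_algebra scale"
    unfolding tensor_algebra_def by (rule abelian_monoid_quotient_algebra)
  let ?P = "{\<sigma>. \<sigma> permutes {..<n}}"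
  let ?a = "\<Sum>\<sigma>\<in>?P. Poly_Mapping.single \<sigma> (c \<sigma>)"
  have fin: "finite ?P"
    by (rule finite_permutations) simp
  have lookup: "Poly_Mapping.lookup ?a \<sigma> = (if \<sigma> permutes {..<n} then c \<sigma> else 0)" for \<sigma>
    using fin by (simp add: lookup_sum lookup_single when_def)
  then have keys: "Poly_Mapping.keys ?a \<subseteq> ?P"
    by (auto simp: in_keys_iff split: if_splits)
  have "group_algebra_action scale V0 V1 n (tensor_class scale p) ?a =
      (\<Oplus>\<^bsub>tensor_algebra scale\<^esub>\<sigma>\<in>Poly_Mapping.keys ?a.
        tensor_class scale (pscale (Poly_Mapping.lookup ?a \<sigma>) (place_linear V0 V1 n \<sigma> p)))"
    unfolding group_algebra_action_def
  proof (rule T.finsum_cong'[OF refl])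
    fix \<sigma> assume "\<sigma> \<in> Poly_Mapping.keys ?a"
    then have "\<sigma> permutes {..<n}"
      using keys by blast
    then show "Poly_Mapping.lookup ?a \<sigma> \<odot>\<^bsub>tensor_algebra scale\<^esub>
        place_action scale V0 V1 n (tensor_class scale p) \<sigma> =
        tensor_class scale (pscale (Poly_Mapping.lookup ?a \<sigma>) (place_linear V0 V1 n \<sigma> p))"
      by (simp add: place_action_class tensor_algebra_def quotient_algebra_simps)
  qed (auto simp: tensor_algebra_def quotient_algebra_simps)
  also have "\<dots> = tensor_class scale (\<Sum>\<sigma>\<in>Poly_Mapping.keys ?a.
      pscale (Poly_Mapping.lookup ?a \<sigma>) (place_linear V0 V1 n \<sigma> p))"
    unfolding tensor_algebra_def by (rule finsum_quotient_algebra)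
  also have "(\<Sum>\<sigma>\<in>Poly_Mapping.keys ?a.
      pscale (Poly_Mapping.lookup ?a \<sigma>) (place_linear V0 V1 n \<sigma> p)) =
      (\<Sum>\<sigma>\<in>?P. pscale (Poly_Mapping.lookup ?a \<sigma>) (place_linear V0 V1 n \<sigma> p))"
    by (rule sum.mono_neutral_left[OF fin keys]) (auto simp: in_keys_iff pscale_0_left)
  also have "\<dots> = (\<Sum>\<sigma>\<in>?P. pscale (c \<sigma>) (place_linear V0 V1 n \<sigma> p))"
    by (rule sum.cong) (simp_all add: lookup)
  finally show ?thesis .
qed

section \<open>Monomials as blocks of places\<close>

lemma concat_blocks:
  fixes vs :: "nat \<Rightarrow> 'v list"
  assumes "W = concat (map vs [1..<Suc d])"
  obtains B where "concat (map B [1..<Suc d]) = [0..<length W]"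
    and "\<And>k. k \<in> {1..d} \<Longrightarrow> map ((!) W) (B k) = vs k"
proof -
  \<comment> \<open>The place where monomial \<open>k\<close> starts. Monomials are numbered from 1
    and places from 0, so \<open>off 1\<close> is 0.\<close>
  define off where "off k = length (concat (map vs [1..<k]))" for k
  define B where "B k = [off k..<off (Suc k)]" for k
  have off: "off (Suc k) = off k + length (vs k)" if "1 \<le> k" for k
    using that by (simp add: off_def)
  have "concat (map B [1..<Suc k]) = [0..<off (Suc k)]" for k
  proof (induction k)
    case 0
    show ?case by (simp add: off_def)
  next
    case (Suc k)
    then show ?case
      using upt_add_eq_append[of 0 "off (Suc k)" "length (vs (Suc k))"] off[of "Suc k"]
      by (simp add: B_def)
  qed
  from this[of d] have "concat (map B [1..<Suc d]) = [0..<length W]"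
    by (simp add: assms off_def)
  moreover have "map ((!) W) (B k) = vs k" if "k \<in> {1..d}" for k
  proof -
    have "[1..<Suc d] = [1..<k] @ k # [Suc k..<Suc d]"
      using that upt_add_eq_append[of 1 k "Suc d - k"] by (simp add: upt_conv_Cons)
    then have "W = concat (map vs [1..<k]) @ vs k @ concat (map vs [Suc k..<Suc d])"
      unfolding assms by simp
    then show ?thesis
      using that off[of k] by (intro nth_equalityI) (auto simp: B_def off_def nth_append)
  qed
  ultimately show thesis ..
qed

lemma mset_concat_map:
  "mset u = mset v \<Longrightarrow> mset (concat (map B u)) = mset (concat (map B v))"
  by (metis mset_concat mset_map sum_mset_sum_list)

text \<open>\<open>T = {}\<close> gives the symmetriser and \<open>T = {..<n}\<close> the antisymmetriser.\<close>

lemma (in graded_vector_space) symmetriser_kills_identity: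
  fixes vs :: "nat \<Rightarrow> 'v list"
  assumes g: "multilinear d g"
    and identity: "polynomial_identity (grassmann_square :: ('f, _) module) g"
    and m: "\<And>k. k \<in> {1..d} \<Longrightarrow> m k = pure_tensor scale (vs k)"
    and T: "T = {} \<or> T = {..<n}"
  shows "group_algebra_action scale V0 V1 n (evaluate (tensor_algebra scale) g m)
      (\<Sum>\<sigma> | \<sigma> permutes {..<n}. Poly_Mapping.single \<sigma> (place_sign n \<sigma> T)) =
    \<zero>\<^bsub>tensor_algebra scale\<^esub>"
proof -
  let ?K = "Poly_Mapping.keys g"
  let ?c = "Poly_Mapping.lookup g"
  define W where "W = concat (map vs [1..<Suc d])"
  have perm: "mset w = mset [1..<Suc d]" if "w \<in> ?K" for w
  proof -
    have "distinct w" "set w = set [1..<Suc d]"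
      using g that by (auto simp: multilinear_def)
    then show ?thesis
      by (subst set_eq_iff_mset_eq_distinct[symmetric]) simp_all
  qed
  have eval: "evaluate (tensor_algebra scale) g m =
      tensor_class scale (\<Sum>w\<in>?K. Poly_Mapping.single (concat (map vs w)) (?c w))"
  proof -
    have "sum_list (map vs w) = concat (map vs w)" for w
      by (induction w) (simp_all add: zero_list_def plus_list_def)
    moreover have "m k = tensor_class scale (Poly_Mapping.single (vs k) 1)"
      if "w \<in> ?K" "k \<in> set w" for w k
      using m[of k] g that by (auto simp: multilinear_def pure_tensor_def)
    ultimately show ?thesis
      unfolding tensor_algebra_def by (subst evaluate_quotient_algebra[where h = vs]) simp_all
  qed
  \<comment> \<open>All words of \<open>g\<close> rearrange the same monomials, so their tensors
    share the length of \<open>W\<close>. If it is not \<open>n\<close>, every term below is zero,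
    since \<open>place_linear\<close> is zero on such words.\<close>
  have len: "length (concat (map vs w)) = length W" if "w \<in> ?K" for w
    using mset_concat_map[OF perm[OF that], of vs] unfolding W_def by (metis size_mset)
  let ?A = "\<Sum>\<sigma> | \<sigma> permutes {..<n}. pscale (place_sign n \<sigma> T) (\<Sum>w\<in>?K.
    place_linear V0 V1 n \<sigma> (Poly_Mapping.single (concat (map vs w)) (?c w)))"
  have "?A = 0"
  proof (cases "length W = n")
    case False
    then show ?thesis
      by (simp add: place_linear_single len pscale_0_right)
  next
    case True
    obtain B where B: "concat (map B [1..<Suc d]) = [0..<n]"
      and WB: "\<And>k. k \<in> {1..d} \<Longrightarrow> map ((!) W) (B k) = vs k"
      using concat_blocks[OF W_def] True by metis
    \<comment> \<open>Listing the blocks in the order of \<open>w\<close> gives a permutation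
      \<open>\<tau> w\<close>: place \<open>i\<close> of the tensor for \<open>w\<close> carries
      factor \<open>\<tau> w i\<close> of \<open>W\<close>.\<close>
    have "\<exists>\<tau>. \<tau> permutes {..<n} \<and> map \<tau> [0..<n] = concat (map B w)" if "w \<in> ?K" for w
    proof -
      have "mset (concat (map B w)) = mset [0..<n]"
        using mset_concat_map[OF perm[OF that], of B] B by simp
      then have "distinct (concat (map B w))" "set (concat (map B w)) = {..<n}"
        by (metis distinct_upt mset_eq_imp_distinct_iff,
            metis mset_eq_setD atLeast_upt)
      then show ?thesis
        by (rule list_permutes) blast
    qed
    then obtain \<tau> where \<tau>: "\<tau> w permutes {..<n}" and map_\<tau>: "map (\<tau> w) [0..<n] = concat (map B w)"
      if "w \<in> ?K" for w
      by metis
    have "(\<Sum>w\<in>?K. ?c w * (place_sign n (\<tau> w) S * place_sign n (\<tau> w) T)) = 0"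
      if S: "S \<subseteq> {..<n}" for S
    proof -
      \<comment> \<open>Replacing variable \<open>k\<close> by the generators of \<open>B k\<close>
        lying in \<open>U\<close> turns \<open>w\<close> into the word of \<open>\<tau> w\<close>
        restricted to \<open>U\<close>. Each element of \<open>U\<close> occurs once, so the
        coefficient is the sorting sign, which is the place sign.\<close>
      have coeff: "word_coeff U (concat (map (\<lambda>k. filter (\<lambda>i. i \<in> U) (B k)) w)) =
          (place_sign n (\<tau> w) U :: 'f)" if w: "w \<in> ?K" and U: "U \<subseteq> {..<n}" for w U
      proof -
        have "distinct (map (\<tau> w) [0..<n])" "set (map (\<tau> w) [0..<n]) = {..<n}"
          using permutes_inj_on[OF \<tau>[OF w]] permutes_image[OF \<tau>[OF w]]
          by (simp_all add: distinct_map lessThan_atLeast0)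
        moreover have "concat (map (\<lambda>k. filter (\<lambda>i. i \<in> U) (B k)) w) =
            filter (\<lambda>i. i \<in> U) (map (\<tau> w) [0..<n])"
          unfolding map_\<tau>[OF w] by (simp add: filter_concat comp_def)
        ultimately show ?thesis
          using U unfolding place_sign_eq_word_sign
          by (auto simp: word_coeff_def simp del: set_map filter_map)
      qed
      have "T \<subseteq> {..<n}"
        using T by auto
      \<comment> \<open>The second tensor factor is 1 for empty \<open>T\<close> and the product
        over the whole block for full \<open>T\<close>.\<close>
      then show ?thesis
        using grassmann_square_identity[OF identity, of S "\<lambda>k. filter (\<lambda>i. i \<in> S) (B k)"
            T "\<lambda>k. filter (\<lambda>i. i \<in> T) (B k)"]
        by (simp add: coeff S)
    qed
    note zero = signed_sum_place_word[OF \<tau> T this]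
    have "concat (map vs w) = map (\<lambda>i. W ! \<tau> w i) [0..<n]" if "w \<in> ?K" for w
    proof -
      have "concat (map vs w) = concat (map (\<lambda>k. map ((!) W) (B k)) w)"
        using g that by (intro arg_cong[of _ _ concat] map_cong) (auto simp: multilinear_def WB)
      also have "\<dots> = map ((!) W) (map (\<tau> w) [0..<n])"
        by (simp add: map_\<tau>[OF that] map_concat comp_def)
      finally show ?thesis
        by (simp add: comp_def)
    qed
    then have "(\<Sum>w\<in>?K. place_linear V0 V1 n \<sigma> (Poly_Mapping.single (concat (map vs w)) (?c w))) =
        (\<Sum>w\<in>?K. pscale (?c w) (place_word V0 V1 n \<sigma> (map (\<lambda>i. W ! \<tau> w i) [0..<n])))" for \<sigma>
      by (intro sum.cong) (simp_all add: place_linear_single)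
    then show ?thesis
      using zero by simp
  qed
  then show ?thesis
    unfolding eval group_algebra_action_class place_linear_sum
    by (simp add: tensor_algebra_def quotient_algebra_simps)
qed

theorem theorem8p1:
  fixes scale :: "'f::field_char_0 \<Rightarrow> 'v::ab_group_add \<Rightarrow> 'v"
    and V0 V1 :: "'v set"
    and g :: "nat list \<Rightarrow>\<^sub>0 'f"
    and m :: "nat \<Rightarrow> ('v list \<Rightarrow>\<^sub>0 'f) set"
    and d n :: nat
  assumes "graded_vector_space scale V0 V1"
    and "multilinear d g"
    and "polynomial_identity (grassmann_square :: ('f, _) module) g"
    and "\<And>i. i \<in> {1..d} \<Longrightarrow> m i \<in> range (pure_tensor scale)"
    and "word_value (tensor_algebra scale) m [1..<Suc d] \<in> tensor_power scale n"
  shows "group_algebra_action scale V0 V1 n (evaluate (tensor_algebra scale) g m) (alt_element n)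
           = \<zero>\<^bsub>tensor_algebra scale\<^esub>
       \<and> group_algebra_action scale V0 V1 n (evaluate (tensor_algebra scale) g m) (sym_element n)
           = \<zero>\<^bsub>tensor_algebra scale\<^esub>"
proof -
  have "\<forall>k\<in>{1..d}. \<exists>v. m k = pure_tensor scale v"
    using assms(4) by blast
  then obtain vs where vs: "m k = pure_tensor scale (vs k)" if "k \<in> {1..d}" for k
    by metis
  \<comment> \<open>With no odd places nothing is inverted, so every sign is 1.\<close>
  have "sym_element n =
      (\<Sum>\<sigma> | \<sigma> permutes {..<n}. Poly_Mapping.single \<sigma> (place_sign n \<sigma> {} :: 'f))"
    by (simp add: sym_element_def place_sign_def)
  moreover have "alt_element n =
      (\<Sum>\<sigma> | \<sigma> permutes {..<n}. Poly_Mapping.single \<sigma> (place_sign n \<sigma> {..<n} :: 'f))"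
    unfolding alt_element_def by (intro sum.cong) (simp_all add: place_sign_eq_sign)
  ultimately show ?thesis
    using graded_vector_space.symmetriser_kills_identity[OF assms(1-3) vs] by simp
qed

end
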